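(* Let $f_{\tau}$ be the density of the distribution of the trace function $\tau(m)=\mathrm{Trace}\, m$ on $G=\mathrm{USp}_4$. If $x\in\mathbb{R}$ and $0<|x|<4$, then $$f_{\tau}(x)=-\frac{64}{15\pi}\,\sqrt{|x|}\left(1-\frac{x^{2}}{16}\right)^{2} P^{2}_{1/2}\left(\frac{x^{2}+16}{8|x|}\right),$$ where $P^{2}_{1/2}$ is the associated Legendre function of the first kind with lower index $1/2$ and upper index $2$.
   Context: $\mathrm{USp}_{4}=\{m\in \mathrm{GL}_{4}(\mathbb{C}) : {}^t m J m=J,\ {}^t m\,\bar m=I_{4}\}$ with $J=\begin{pmatrix}0&I_2\\-I_2&0\end{pmatrix}$, equipped with the Haar measure $dm$ of total mass $1$. The trace $\tau(m)=\mathrm{Trace}\, m$ is real with values in $[-4,4]$; its distribution is the image of $dm$ under $\tau$, and $f_\tau$ denotes the continuous density of this distribution: $\int_G\varphi(\tau(m))\,dm=\int_{-4}^{4}\varphi(x)f_\tau(x)\,dx$ for every continuous $\varphi$ on $[-4,4]$. For an integer $m\ge 0$ and real $z>1$, the associated Legendre function of the first kind is $$P_b^m(z)=\frac{(b+1)_m}{\pi}\int_0^\pi\left(z+\sqrt{z^2-1}\cos\varphi\right)^b\cos m\varphi\,d\varphi,$$ with $(a)_n=a(a+1)\cdots(a+n-1)$. *)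

theory Defs
  imports "HOL-Probability.Probability"
begin

text \<open>The block matrix with rows \<open>(0, I)\<close> and \<open>(-I, 0)\<close>, where \<open>I\<close> is the 2 by 2 identity.\<close>

definition sympl_J :: "complex^4^4" where
  "sympl_J = vector [vector [ 0,  0, 1, 0],
                     vector [ 0,  0, 0, 1],
                     vector [-1,  0, 0, 0],
                     vector [ 0, -1, 0, 0]]"

definition USp4 :: "(complex^4^4) set" where
  "USp4 = {m. invertible m \<and> transpose m ** sympl_J ** m = sympl_J
              \<and> transpose m ** map_matrix cnj m = mat 1}"

text \<open>
  A Haar measure of total mass 1 on a set \<open>G\<close> of matrices forming a compact group: a left-invariant
  Borel probability measure on \<open>G\<close>. Regularity is automatic for a finite Borel measure on a compact
  metrizable space, and such a measure is unique, so this predicate pins down the Haar measure.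
\<close>

definition normalized_haar :: "(complex^'n^'n) set \<Rightarrow> (complex^'n^'n) measure \<Rightarrow> bool" where
  "normalized_haar G M \<longleftrightarrow>
     prob_space M \<and> space M = G \<and> sets M = sets (restrict_space borel G) \<and>
     (\<forall>g\<in>G. distr M M (\<lambda>m. g ** m) = M)"

text \<open>
  Taking the real part loses nothing on \<open>USp4\<close>; see \<open>of_real_tau\<close> and \<open>tau_bounds\<close> below.
\<close>

definition tau :: "complex^4^4 \<Rightarrow> real" where
  "tau m = Re (trace m)"

text \<open>\<open>f\<close> is the continuous density on \<open>[-4, 4]\<close> of the image of \<open>M\<close> under \<open>tau\<close>; values of \<open>f\<close>
  outside \<open>[-4, 4]\<close> are irrelevant.\<close>

definition continuous_tau_density :: "(complex^4^4) measure \<Rightarrow> (real \<Rightarrow> real) \<Rightarrow> bool" where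
  "continuous_tau_density M f \<longleftrightarrow>
     continuous_on {-4..4} f \<and>
     (\<forall>\<phi> :: real \<Rightarrow> real. continuous_on {-4..4} \<phi> \<longrightarrow>
        (\<integral>m. \<phi> (tau m) \<partial>M) = integral {-4..4} (\<lambda>x. \<phi> x * f x))"

text \<open>Associated Legendre function of the first kind, lower index \<open>b\<close>, upper index \<open>m\<close>, for \<open>z > 1\<close>;
  there the base of the power is positive.\<close>

definition assoc_legendre_P :: "real \<Rightarrow> nat \<Rightarrow> real \<Rightarrow> real" where
  "assoc_legendre_P b m z =
     pochhammer (b + 1) m / pi *
     integral {0..pi} (\<lambda>t. (z + sqrt (z\<^sup>2 - 1) * cos t) powr b * cos (real m * t))"

lemma sympl_J_nth:
  "sympl_J $ i $ j =
     (if (i, j) = (1, 3) \<or> (i, j) = (2, 4) then 1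
      else if (i, j) = (3, 1) \<or> (i, j) = (4, 2) then -1 else 0)"
  using exhaust_4[of i] exhaust_4[of j] by (auto simp: sympl_J_def vector_def)

lemma sympl_J_square: "sympl_J ** sympl_J = - mat 1"
  by (simp add: vec_eq_iff forall_4 matrix_matrix_mult_def sum_4 sympl_J_nth mat_def)

lemma USp4_inverse:
  assumes "m \<in> USp4"
  shows "m ** transpose (map_matrix cnj m) = mat 1" "transpose (map_matrix cnj m) ** m = mat 1"
proof -
  have "transpose m ** map_matrix cnj m = mat 1"
    using assms by (simp add: USp4_def)
  then have "transpose (transpose m ** map_matrix cnj m) = mat 1"
    by (simp add: transpose_mat)
  then show 1: "transpose (map_matrix cnj m) ** m = mat 1"
    by (simp add: matrix_transpose_mul)
  then show "m ** transpose (map_matrix cnj m) = mat 1"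
    by (simp add: matrix_left_right_inverse)
qed

lemma of_real_tau:
  assumes "m \<in> USp4"
  shows "complex_of_real (tau m) = trace m"
proof -
  let ?h = "transpose (map_matrix cnj m)"
  have "transpose m ** sympl_J ** m = sympl_J"
    using assms by (simp add: USp4_def)
  then have "transpose m ** sympl_J ** (m ** ?h) = sympl_J ** ?h"
    by (metis matrix_mul_assoc)
  then have "transpose m ** sympl_J = sympl_J ** ?h"
    using USp4_inverse[OF assms] by simp
  then have "trace (transpose m ** sympl_J ** sympl_J) = trace (sympl_J ** ?h ** sympl_J)"
    by simp
  also have "\<dots> = trace (sympl_J ** sympl_J ** ?h)"
    by (metis matrix_mul_assoc trace_mul_sym)
  finally have "trace (transpose m ** (- mat 1)) = trace ((- mat 1) ** ?h)"
    by (metis sympl_J_square matrix_mul_assoc)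
  then have "- trace m = - trace ?h"
    by (simp add: trace_def matrix_matrix_mult_def sum_4 mat_def transpose_def)
  then have "trace m = trace ?h"
    by simp
  also have "\<dots> = cnj (trace m)"
    by (simp add: trace_def transpose_def)
  finally show ?thesis
    by (simp add: tau_def complex_eq_iff)
qed

lemma tau_bounds:
  assumes "m \<in> USp4"
  shows "tau m \<in> {-4..4}"
proof -
  have "cmod (m $ i $ i) \<le> 1" for i
  proof -
    have "(\<Sum>k\<in>UNIV. m $ i $ k * cnj (m $ i $ k)) = 1"
      using USp4_inverse(1)[OF assms]
      by (simp add: vec_eq_iff matrix_matrix_mult_def transpose_def mat_def)
    then have "complex_of_real (\<Sum>k\<in>UNIV. (cmod (m $ i $ k))\<^sup>2) = complex_of_real 1"
      by (simp del: of_real_power add: complex_norm_square)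
    then have "(\<Sum>k\<in>UNIV. (cmod (m $ i $ k))\<^sup>2) = 1"
      using of_real_eq_iff by blast
    moreover have "(cmod (m $ i $ i))\<^sup>2 \<le> (\<Sum>k\<in>UNIV. (cmod (m $ i $ k))\<^sup>2)"
      by (rule member_le_sum) auto
    ultimately show ?thesis
      by (simp add: power_le_one_iff abs_square_le_1)
  qed
  then have "\<bar>Re (m $ i $ i)\<bar> \<le> 1" for i
    using abs_Re_le_cmod order_trans by blast
  from this[of 1] this[of 2] this[of 3] this[of 4] show ?thesis
    by (simp add: tau_def trace_def sum_4 abs_le_iff)
qed

end

theory Submission
  imports Defs
begin

text \<open>
  Identify \<open>USp4\<close> with the unitary 2 by 2 quaternionic matrices, with first column \<open>(p, w)\<close> and second
  diagonal entry \<open>q\<close>. Then \<open>\<bar>p\<bar>\<^sup>2 = \<bar>q\<bar>\<^sup>2 = 1 - \<bar>w\<bar>\<^sup>2\<close> and \<open>tau = 2 (Re p + Re q)\<close>. Differentiating the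
  left invariance of the Haar measure along rotations within a row and between the two rows gives
  recurrences for the mixed moments of \<open>Re p\<close>, \<open>Re q\<close> and \<open>\<bar>p\<bar>\<^sup>2\<close>, hence all moments of \<open>tau\<close> (the sum
  over the ways to split a moment between \<open>Re p\<close> and \<open>Re q\<close> is a Vandermonde convolution).

  On the other side, two integrations by parts and a substitution turn the Legendre integral into
  \<open>\<integral> ((t\<^sup>2 - u\<^sup>2) (1 - t\<^sup>2)) powr (3/2) / t\<^sup>2 dt\<close> over \<open>{u..1}\<close>, where \<open>u = \<bar>x\<bar> / 4\<close>. This is a multiplicative
  convolution, so its moments factor into two Beta integrals; they agree with those of \<open>tau\<close>. Two
  continuous functions on \<open>{-4..4}\<close> with the same moments are equal.
\<close>

section \<open>Moments from rotation invariance\<close>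

text \<open>The difference quotients at 0 have integral 0, because the integral of
  \<open>h t\<close> is constant in \<open>t\<close>. The mean value theorem bounds them by
  \<open>C\<close>, so dominated convergence on a finite measure carries this over to the
  derivative.\<close>

lemma integral_deriv_eq_0:
  fixes h h' :: "real \<Rightarrow> 'a \<Rightarrow> real"
  assumes "finite_measure M"
    and meas: "\<And>t. h t \<in> borel_measurable M"
    and int0: "\<And>t. integrable M (h t)"
    and der: "\<And>t m. m \<in> space M \<Longrightarrow> ((\<lambda>t. h t m) has_real_derivative h' t m) (at t)"
    and bnd: "\<And>t m. m \<in> space M \<Longrightarrow> \<bar>h' t m\<bar> \<le> C"
    and const: "\<And>t. (\<integral>m. h t m \<partial>M) = c"
  shows "(\<integral>m. h' 0 m \<partial>M) = 0"
proof -
  interpret finite_measure M by fact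
  define e where "e n = 1 / real (Suc n)" for n
  have e: "e n > 0" for n by (simp add: e_def)
  have e0: "e \<longlonglongrightarrow> 0"
    unfolding e_def by (rule LIMSEQ_Suc[OF lim_1_over_n])
  define q where "q n m = (h (e n) m - h 0 m) / e n" for n m
  have q0: "(\<integral>m. q n m \<partial>M) = 0" for n
    unfolding q_def using int0 const by simp
  have lim: "(\<lambda>n. q n m) \<longlonglongrightarrow> h' 0 m" if "m \<in> space M" for m
  proof -
    have "((\<lambda>y. (h y m - h 0 m) / (y - 0)) \<longlongrightarrow> h' 0 m) (at 0)"
      using der[OF that, of 0] by (simp add: has_field_derivative_iff)
    moreover have "filterlim e (at 0) sequentially"
      unfolding filterlim_at using e e0 by (simp add: less_imp_neq[symmetric])
    ultimately have "((\<lambda>n. (h (e n) m - h 0 m) / (e n - 0)) \<longlongrightarrow> h' 0 m) sequentially"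
      by (rule filterlim_compose)
    then show ?thesis by (simp add: q_def)
  qed
  have "\<bar>q n m\<bar> \<le> C" if m: "m \<in> space M" for n m
  proof -
    obtain z where "h (e n) m - h 0 m = (e n - 0) * h' z m"
      using MVT2[of 0 "e n" "\<lambda>t. h t m" "\<lambda>t. h' t m"] e[of n] der[OF m] by blast
    then have "q n m = h' z m"
      using e[of n] by (simp add: q_def)
    then show ?thesis using bnd[OF m] by simp
  qed
  moreover have [measurable]: "q n \<in> borel_measurable M" for n
    unfolding q_def using meas by measurable
  moreover have "h' 0 \<in> borel_measurable M"
    by (rule borel_measurable_LIMSEQ_real[where u = q]) (use lim in auto)
  ultimately have "(\<lambda>n. \<integral>m. q n m \<partial>M) \<longlonglongrightarrow> (\<integral>m. h' 0 m \<partial>M)"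
    by (intro integral_dominated_convergence[where w = "\<lambda>_. C"]) (simp_all add: lim)
  then show ?thesis
    by (simp add: q0 LIMSEQ_const_iff)
qed

text \<open>The derivative at \<open>t = 0\<close> of the invariance under rotations of the pair \<open>(A, B)\<close>.\<close>

lemma rotation_moment:
  fixes A B H :: "'a \<Rightarrow> real" and r :: real
  assumes "prob_space M"
    and meas [measurable]: "A \<in> borel_measurable M" "B \<in> borel_measurable M" "H \<in> borel_measurable M"
    and A: "\<And>m. m \<in> space M \<Longrightarrow> \<bar>A m\<bar> \<le> 1"
    and B: "\<And>m. m \<in> space M \<Longrightarrow> \<bar>B m\<bar> \<le> 1"
    and H: "\<And>m. m \<in> space M \<Longrightarrow> \<bar>H m\<bar> \<le> 1"
    and const: "\<And>t. (\<integral>m. (cos t * A m + sin t * B m) * (cos t * B m - sin t * A m + r) ^ k * H m \<partial>M)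
                 = (\<integral>m. A m * (B m + r) ^ k * H m \<partial>M)"
  shows "(\<integral>m. B m * (B m + r) ^ k * H m \<partial>M) = k * (\<integral>m. (A m)\<^sup>2 * (B m + r) ^ (k - 1) * H m \<partial>M)"
proof -
  interpret prob_space M by fact
  define X where "X t m = cos t * A m + sin t * B m" for t m
  define Y where "Y t m = cos t * B m - sin t * A m" for t m
  have [measurable]: "X t \<in> borel_measurable M" "Y t \<in> borel_measurable M" for t
    unfolding X_def Y_def by measurable
  have cs: "\<bar>cos t * a\<bar> \<le> 1" "\<bar>sin t * a\<bar> \<le> 1" if "\<bar>a\<bar> \<le> 1" for t a :: real
    using that mult_mono[of "\<bar>cos t\<bar>" 1 "\<bar>a\<bar>" 1] mult_mono[of "\<bar>sin t\<bar>" 1 "\<bar>a\<bar>" 1]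
    by (auto simp: abs_mult)
  have X: "\<bar>X t m\<bar> \<le> 2" and Y: "\<bar>Y t m\<bar> \<le> 2" if "m \<in> space M" for t m
    using cs[OF A[OF that], of t] cs[OF B[OF that], of t] unfolding X_def Y_def by linarith+
  have Yr: "\<bar>(Y t m + r) ^ j\<bar> \<le> (2 + \<bar>r\<bar>) ^ j" if "m \<in> space M" for t m j
    using Y[OF that, of t] by (auto simp: power_abs intro!: power_mono)
  have X2: "\<bar>(X t m)\<^sup>2\<bar> \<le> 2\<^sup>2" if "m \<in> space M" for t m
    using power_mono[OF X[OF that, of t] abs_ge_zero, of 2] by simp
  let ?h = "\<lambda>t m. X t m * (Y t m + r) ^ k * H m"
  \<comment> \<open>Computed from X' = Y and Y' = - X. For \<open>k = 0\<close> the truncated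
    exponent \<open>k - 1\<close> is harmless, since its term carries the factor
    \<open>k\<close>.\<close>
  let ?h' = "\<lambda>t m. (Y t m * (Y t m + r) ^ k - k * ((X t m)\<^sup>2 * (Y t m + r) ^ (k - 1))) * H m"
  have b0: "\<bar>?h t m\<bar> \<le> 2 * (2 + \<bar>r\<bar>) ^ k * 1" if "m \<in> space M" for t m
    unfolding abs_mult using that X Yr H by (intro mult_mono) auto
  have b1: "\<bar>Y t m * (Y t m + r) ^ k * H m\<bar> \<le> 2 * (2 + \<bar>r\<bar>) ^ k * 1" if "m \<in> space M" for t m
    unfolding abs_mult using that Y Yr H by (intro mult_mono) auto
  have b2: "\<bar>(X t m)\<^sup>2 * (Y t m + r) ^ (k - 1) * H m\<bar> \<le> 2\<^sup>2 * (2 + \<bar>r\<bar>) ^ (k - 1) * 1"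
    if "m \<in> space M" for t m
    unfolding abs_mult[of "(X t m)\<^sup>2 * _"] abs_mult[of "(X t m)\<^sup>2"]
    using X2[OF that, of t] Yr[OF that, of t] H[OF that] by (intro mult_mono) auto
  have i0: "integrable M (?h t)" for t
    using b0 by (intro integrable_const_bound) auto
  have "(\<integral>m. ?h' 0 m \<partial>M) = 0"
  proof (rule integral_deriv_eq_0)
    show "finite_measure M" by unfold_locales
    show "integrable M (?h t)" for t by (rule i0)
    show "((\<lambda>t. ?h t m) has_real_derivative ?h' t m) (at t)" for t m
      unfolding X_def Y_def
      by (rule derivative_eq_intros refl | simp)+ (simp add: algebra_simps power2_eq_square)
    show "\<bar>?h' t m\<bar> \<le> 2 * (2 + \<bar>r\<bar>) ^ k * 1 + k * (2\<^sup>2 * (2 + \<bar>r\<bar>) ^ (k - 1) * 1)"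
      if m: "m \<in> space M" for t m
    proof -
      have "\<bar>?h' t m\<bar> \<le> \<bar>Y t m * (Y t m + r) ^ k * H m\<bar> + \<bar>k * ((X t m)\<^sup>2 * (Y t m + r) ^ (k - 1) * H m)\<bar>"
        using abs_triangle_ineq4 by (simp add: algebra_simps)
      also have "\<bar>k * ((X t m)\<^sup>2 * (Y t m + r) ^ (k - 1) * H m)\<bar> = k * \<bar>(X t m)\<^sup>2 * (Y t m + r) ^ (k - 1) * H m\<bar>"
        by (simp add: abs_mult)
      also have "\<dots> \<le> k * (2\<^sup>2 * (2 + \<bar>r\<bar>) ^ (k - 1) * 1)"
        by (rule mult_left_mono[OF b2[OF m]]) simp
      finally show ?thesis using b1[OF m, of t] by linarith
    qed
    show "(\<integral>m. ?h t m \<partial>M) = (\<integral>m. A m * (B m + r) ^ k * H m \<partial>M)" for t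
      using const by (simp add: X_def Y_def)
  qed auto
  moreover have "integrable M (\<lambda>m. Y 0 m * (Y 0 m + r) ^ k * H m)"
    using b1 by (intro integrable_const_bound) auto
  moreover have "integrable M (\<lambda>m. (X 0 m)\<^sup>2 * (Y 0 m + r) ^ (k - 1) * H m)"
    using b2 by (intro integrable_const_bound) auto
  ultimately show ?thesis
    by (simp add: X_def Y_def left_diff_distrib mult.assoc)
qed

section \<open>Quaternionic coordinates on USp(4)\<close>

text \<open>The quaternions \<open>x1 + x3 j\<close>, \<open>x2 + x4 j\<close> form the first row of the quaternionic matrix, and
  \<open>y1 + y3 j\<close>, \<open>y2 + y4 j\<close> the second.\<close>

definition quat_mat :: "complex \<Rightarrow> complex \<Rightarrow> complex \<Rightarrow> complex \<Rightarrow> complex \<Rightarrow> complex \<Rightarrow> complex \<Rightarrow> complex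
    \<Rightarrow> complex^4^4" where
  "quat_mat x1 x2 x3 x4 y1 y2 y3 y4 =
     vector [vector [x1, x2, x3, x4],
             vector [y1, y2, y3, y4],
             vector [- cnj x3, - cnj x4, cnj x1, cnj x2],
             vector [- cnj y3, - cnj y4, cnj y1, cnj y2]]"

lemma vector_4_nth:
  "(vector [a, b, c, d] :: 'a::zero^4) $ 1 = a" "(vector [a, b, c, d] :: 'a^4) $ 2 = b"
  "(vector [a, b, c, d] :: 'a^4) $ 3 = c" "(vector [a, b, c, d] :: 'a^4) $ 4 = d"
  by (simp_all add: vector_def)

lemmas quat_mat_nth = quat_mat_def vector_4_nth

text \<open>The hypotheses \<open>xy\<close> and \<open>J\<close> make row 1 orthogonal to rows 2
  and 4, which is orthogonality of the two quaternionic rows. The remaining Hermitian products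
  follow by conjugation or cancel identically.\<close>

lemma quat_mat_in_USp4:
  assumes x: "x1 * cnj x1 + x2 * cnj x2 + x3 * cnj x3 + x4 * cnj x4 = 1"
    and y: "y1 * cnj y1 + y2 * cnj y2 + y3 * cnj y3 + y4 * cnj y4 = 1"
    and xy: "x1 * cnj y1 + x2 * cnj y2 + x3 * cnj y3 + x4 * cnj y4 = 0"
    and J: "x1 * y3 + x2 * y4 = x3 * y1 + x4 * y2"
  shows "quat_mat x1 x2 x3 x4 y1 y2 y3 y4 \<in> USp4"
proof -
  let ?q = "quat_mat x1 x2 x3 x4 y1 y2 y3 y4"
  have yx: "y1 * cnj x1 + y2 * cnj x2 + y3 * cnj x3 + y4 * cnj x4 = 0"
    using arg_cong[OF xy, of cnj] by (simp add: mult.commute)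
  have J': "cnj x1 * cnj y3 + cnj x2 * cnj y4 = cnj x3 * cnj y1 + cnj x4 * cnj y2"
    using arg_cong[OF J, of cnj] by simp
  have 1: "?q ** transpose (map_matrix cnj ?q) = mat 1"
    using x y xy yx J J'
    by (simp add: vec_eq_iff forall_4 matrix_matrix_mult_def sum_4 quat_mat_nth mat_def
        transpose_def algebra_simps eq_neg_iff_add_eq_0)
  then have 2: "transpose (map_matrix cnj ?q) ** ?q = mat 1"
    by (simp add: matrix_left_right_inverse)
  have 3: "transpose ?q ** map_matrix cnj ?q = mat 1"
    using arg_cong[OF 2, of transpose] by (simp add: matrix_transpose_mul)
  have inv: "invertible ?q"
    using 1 2 unfolding invertible_def by blast
  \<comment> \<open>The block shape alone gives this intertwining relation, so the symplectic
    condition reduces to unitarity.\<close>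
  have "transpose ?q ** sympl_J = sympl_J ** transpose (map_matrix cnj ?q)"
    by (simp add: vec_eq_iff forall_4 matrix_matrix_mult_def sum_4 quat_mat_nth sympl_J_nth
        transpose_def)
  then have "transpose ?q ** sympl_J ** ?q = sympl_J ** (transpose (map_matrix cnj ?q) ** ?q)"
    by (simp add: matrix_mul_assoc)
  then show ?thesis
    using 2 3 inv by (simp add: USp4_def)
qed

lemma USp4_mult_closed:
  assumes "g \<in> USp4" "m \<in> USp4"
  shows "g ** m \<in> USp4"
proof -
  have g: "transpose g ** sympl_J ** g = sympl_J" "transpose g ** map_matrix cnj g = mat 1"
    and m: "transpose m ** sympl_J ** m = sympl_J" "transpose m ** map_matrix cnj m = mat 1"
    using assms by (simp_all add: USp4_def)
  have "transpose (g ** m) ** sympl_J ** (g ** m) = transpose m ** (transpose g ** sympl_J ** g) ** m"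
    by (simp add: matrix_transpose_mul matrix_mul_assoc)
  moreover have "map_matrix cnj (g ** m) = map_matrix cnj g ** map_matrix cnj m"
    by (simp add: vec_eq_iff matrix_matrix_mult_def)
  then have "transpose (g ** m) ** map_matrix cnj (g ** m)
      = transpose m ** (transpose g ** map_matrix cnj g) ** map_matrix cnj m"
    by (simp add: matrix_transpose_mul matrix_mul_assoc)
  ultimately show ?thesis
    using assms g m by (simp add: USp4_def invertible_mult)
qed

text \<open>Unitarity turns the symplectic relation into
  \<open>transpose m ** sympl_J = sympl_J ** ?h\<close>. Comparing entries shows that every element
  is a \<open>quat_mat\<close> determined by its first two rows.\<close>

lemma USp4_rows_3_4:
  assumes "m \<in> USp4"
  shows "m $ 3 $ 1 = - cnj (m $ 1 $ 3)" "m $ 3 $ 2 = - cnj (m $ 1 $ 4)"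
    "m $ 3 $ 3 = cnj (m $ 1 $ 1)" "m $ 3 $ 4 = cnj (m $ 1 $ 2)"
    "m $ 4 $ 1 = - cnj (m $ 2 $ 3)" "m $ 4 $ 2 = - cnj (m $ 2 $ 4)"
    "m $ 4 $ 3 = cnj (m $ 2 $ 1)" "m $ 4 $ 4 = cnj (m $ 2 $ 2)"
proof -
  let ?h = "transpose (map_matrix cnj m)"
  have "transpose m ** sympl_J ** m = sympl_J"
    using assms by (simp add: USp4_def)
  then have "transpose m ** sympl_J ** (m ** ?h) = sympl_J ** ?h"
    by (metis matrix_mul_assoc)
  then have "transpose m ** sympl_J = sympl_J ** ?h"
    using USp4_inverse[OF assms] by simp
  then have eq: "(\<Sum>k\<in>UNIV. m $ k $ i * sympl_J $ k $ j) = (\<Sum>k\<in>UNIV. sympl_J $ i $ k * cnj (m $ j $ k))" for i j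
    by (simp add: vec_eq_iff matrix_matrix_mult_def transpose_def)
  show "m $ 3 $ 1 = - cnj (m $ 1 $ 3)" "m $ 3 $ 2 = - cnj (m $ 1 $ 4)"
    "m $ 3 $ 3 = cnj (m $ 1 $ 1)" "m $ 3 $ 4 = cnj (m $ 1 $ 2)"
    "m $ 4 $ 1 = - cnj (m $ 2 $ 3)" "m $ 4 $ 2 = - cnj (m $ 2 $ 4)"
    "m $ 4 $ 3 = cnj (m $ 2 $ 1)" "m $ 4 $ 4 = cnj (m $ 2 $ 2)"
    using eq[of 1 1] eq[of 2 1] eq[of 3 1] eq[of 4 1] eq[of 1 2] eq[of 2 2] eq[of 3 2] eq[of 4 2]
    by (simp_all add: sum_4 sympl_J_nth minus_equation_iff[of "m $ i $ j" for i j])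
qed

lemma quat_mat_mult_nth:
  assumes "m \<in> USp4"
  shows "(quat_mat x1 x2 x3 x4 y1 y2 y3 y4 ** m) $ 1 $ 1
      = x1 * m$1$1 + x2 * m$2$1 - x3 * cnj (m$1$3) - x4 * cnj (m$2$3)"
    "(quat_mat x1 x2 x3 x4 y1 y2 y3 y4 ** m) $ 1 $ 3
      = x1 * m$1$3 + x2 * m$2$3 + x3 * cnj (m$1$1) + x4 * cnj (m$2$1)"
    "(quat_mat x1 x2 x3 x4 y1 y2 y3 y4 ** m) $ 2 $ 1
      = y1 * m$1$1 + y2 * m$2$1 - y3 * cnj (m$1$3) - y4 * cnj (m$2$3)"
    "(quat_mat x1 x2 x3 x4 y1 y2 y3 y4 ** m) $ 2 $ 3
      = y1 * m$1$3 + y2 * m$2$3 + y3 * cnj (m$1$1) + y4 * cnj (m$2$1)"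
    "(quat_mat x1 x2 x3 x4 y1 y2 y3 y4 ** m) $ 2 $ 2
      = y1 * m$1$2 + y2 * m$2$2 - y3 * cnj (m$1$4) - y4 * cnj (m$2$4)"
    "(quat_mat x1 x2 x3 x4 y1 y2 y3 y4 ** m) $ 2 $ 4
      = y1 * m$1$4 + y2 * m$2$4 + y3 * cnj (m$1$2) + y4 * cnj (m$2$2)"
  by (simp_all add: matrix_matrix_mult_def sum_4 quat_mat_nth USp4_rows_3_4[OF assms])

text \<open>Column 1 and row 2 are unit vectors. Together the two identities give |p|^2 = |q|^2 = 1
  - |w|^2.\<close>

lemma USp4_norms:
  assumes "m \<in> USp4"
  shows "(cmod (m$1$1))\<^sup>2 + (cmod (m$1$3))\<^sup>2 + (cmod (m$2$1))\<^sup>2 + (cmod (m$2$3))\<^sup>2 = 1"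
    and "(cmod (m$2$1))\<^sup>2 + (cmod (m$2$2))\<^sup>2 + (cmod (m$2$3))\<^sup>2 + (cmod (m$2$4))\<^sup>2 = 1"
proof -
  have "(\<Sum>k\<in>UNIV. cnj (m $ k $ 1) * m $ k $ 1) = 1" "(\<Sum>k\<in>UNIV. m $ 2 $ k * cnj (m $ 2 $ k)) = 1"
    using USp4_inverse[OF assms]
    by (simp_all add: vec_eq_iff matrix_matrix_mult_def transpose_def mat_def)
  then have "complex_of_real ((cmod (m$1$1))\<^sup>2 + (cmod (m$1$3))\<^sup>2 + (cmod (m$2$1))\<^sup>2 + (cmod (m$2$3))\<^sup>2) = complex_of_real 1"
    "complex_of_real ((cmod (m$2$1))\<^sup>2 + (cmod (m$2$2))\<^sup>2 + (cmod (m$2$3))\<^sup>2 + (cmod (m$2$4))\<^sup>2) = complex_of_real 1"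
    by (simp_all del: of_real_power add: complex_norm_square sum_4 USp4_rows_3_4[OF assms] algebra_simps)
  then show "(cmod (m$1$1))\<^sup>2 + (cmod (m$1$3))\<^sup>2 + (cmod (m$2$1))\<^sup>2 + (cmod (m$2$3))\<^sup>2 = 1"
    "(cmod (m$2$1))\<^sup>2 + (cmod (m$2$2))\<^sup>2 + (cmod (m$2$3))\<^sup>2 + (cmod (m$2$4))\<^sup>2 = 1"
    by (simp_all only: of_real_eq_iff)
qed

lemma USp4_tau: "m \<in> USp4 \<Longrightarrow> tau m = 2 * (Re (m$1$1) + Re (m$2$2))"
  by (simp add: tau_def trace_def sum_4 USp4_rows_3_4)

section \<open>Invariance of Haar integrals\<close>

lemma normalized_haar_measurable:
  fixes F :: "complex^'n^'n \<Rightarrow> real"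
  assumes "normalized_haar G M" "continuous_on UNIV F"
  shows "F \<in> borel_measurable M"
proof -
  have "F \<in> borel_measurable (restrict_space borel G)"
    by (intro measurable_restrict_space1 borel_measurable_continuous_onI assms)
  then show ?thesis
    using assms(1) by (subst measurable_cong_sets) (auto simp: normalized_haar_def)
qed

lemma normalized_haar_integral_left_mult:
  fixes F :: "complex^'n^'n \<Rightarrow> real"
  assumes haar: "normalized_haar G M"
    and g: "g \<in> G" "\<And>m. m \<in> G \<Longrightarrow> g ** m \<in> G"
    and F: "continuous_on UNIV F"
  shows "(\<integral>m. F (g ** m) \<partial>M) = (\<integral>m. F m \<partial>M)"
proof -
  have M: "space M = G" "sets M = sets (restrict_space borel G)" "distr M M (\<lambda>m. g ** m) = M"
    using haar g by (auto simp: normalized_haar_def)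
  have "continuous_on UNIV (\<lambda>m. g ** m)"
    unfolding matrix_matrix_mult_def by (intro continuous_intros)
  then have "(\<lambda>m. g ** m) \<in> restrict_space borel G \<rightarrow>\<^sub>M restrict_space borel G"
    using g by (intro measurable_restrict_space3 borel_measurable_continuous_onI) auto
  then have "(\<lambda>m. g ** m) \<in> M \<rightarrow>\<^sub>M M"
    using measurable_cong_sets[OF M(2) M(2)] by simp
  then have "(\<integral>m. F m \<partial>distr M M (\<lambda>m. g ** m)) = (\<integral>m. F (g ** m) \<partial>M)"
    using normalized_haar_measurable[OF haar F] by (intro integral_distr)
  then show ?thesis using M(3) by simp
qed

text \<open>Left invariance makes the integral in \<open>rotation_moment\<close> independent of
  \<open>t\<close>. The shift \<open>r\<close> is 0 for rotations within a row and 1/2 for those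
  mixing the rows, where the rotated coordinate is \<open>quat_normsq m - 1/2\<close> but powers of
  \<open>quat_normsq m\<close> are wanted.\<close>

lemma haar_rotation_moment:
  fixes A B H :: "complex^4^4 \<Rightarrow> real" and r :: real
  assumes haar: "normalized_haar USp4 M"
    and cont: "continuous_on UNIV A" "continuous_on UNIV B" "continuous_on UNIV H"
    and A: "\<And>m. m \<in> USp4 \<Longrightarrow> \<bar>A m\<bar> \<le> 1"
    and B: "\<And>m. m \<in> USp4 \<Longrightarrow> \<bar>B m\<bar> \<le> 1"
    and H: "\<And>m. m \<in> USp4 \<Longrightarrow> \<bar>H m\<bar> \<le> 1"
    and g: "\<And>t. g t \<in> USp4"
    and gA: "\<And>t m. m \<in> USp4 \<Longrightarrow> A (g t ** m) = cos t * A m + sin t * B m"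
    and gB: "\<And>t m. m \<in> USp4 \<Longrightarrow> B (g t ** m) = cos t * B m - sin t * A m"
    and gH: "\<And>t m. m \<in> USp4 \<Longrightarrow> H (g t ** m) = H m"
  shows "(\<integral>m. B m * (B m + r) ^ k * H m \<partial>M) = k * (\<integral>m. (A m)\<^sup>2 * (B m + r) ^ (k - 1) * H m \<partial>M)"
proof (rule rotation_moment)
  have sp: "space M = USp4" using haar by (simp add: normalized_haar_def)
  show "prob_space M" using haar by (simp add: normalized_haar_def)
  show "A \<in> borel_measurable M" "B \<in> borel_measurable M" "H \<in> borel_measurable M"
    using cont by (auto intro: normalized_haar_measurable[OF haar])
  show "m \<in> space M \<Longrightarrow> \<bar>A m\<bar> \<le> 1" "m \<in> space M \<Longrightarrow> \<bar>B m\<bar> \<le> 1" "m \<in> space M \<Longrightarrow> \<bar>H m\<bar> \<le> 1" for m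
    using A B H sp by auto
  fix t
  have "(\<integral>m. A m * (B m + r) ^ k * H m \<partial>M)
      = (\<integral>m. A (g t ** m) * (B (g t ** m) + r) ^ k * H (g t ** m) \<partial>M)"
    by (rule normalized_haar_integral_left_mult[symmetric, OF haar])
       (auto intro!: USp4_mult_closed g continuous_intros cont)
  also have "\<dots> = (\<integral>m. (cos t * A m + sin t * B m) * (cos t * B m - sin t * A m + r) ^ k * H m \<partial>M)"
    by (rule Bochner_Integration.integral_cong) (simp_all add: sp gA gB gH)
  finally show "(\<integral>m. (cos t * A m + sin t * B m) * (cos t * B m - sin t * A m + r) ^ k * H m \<partial>M)
      = (\<integral>m. A m * (B m + r) ^ k * H m \<partial>M)" by simp
qed

section \<open>Rotations within a row\<close>

text \<open>The squared norm of the quaternion \<open>p = m$1$1 + m$1$3 j\<close>; the other coordinates are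
  \<open>q = m$2$2 + m$2$4 j\<close> and \<open>w = m$2$1 + m$2$3 j\<close>.\<close>

definition quat_normsq :: "complex^4^4 \<Rightarrow> real" where
  "quat_normsq m = (cmod (m$1$1))\<^sup>2 + (cmod (m$1$3))\<^sup>2"

lemma quat_normsq_Re_Im: "quat_normsq m = (Re (m$1$1))\<^sup>2 + (Im (m$1$1))\<^sup>2 + (Re (m$1$3))\<^sup>2 + (Im (m$1$3))\<^sup>2"
  by (simp add: quat_normsq_def cmod_power2)

lemma quat_normsq_2: "m \<in> USp4 \<Longrightarrow> quat_normsq m = (cmod (m$2$2))\<^sup>2 + (cmod (m$2$4))\<^sup>2"
  using USp4_norms[of m] by (simp add: quat_normsq_def)

lemma quat_normsq_2_Re_Im:
  "m \<in> USp4 \<Longrightarrow> quat_normsq m = (Re (m$2$2))\<^sup>2 + (Im (m$2$2))\<^sup>2 + (Re (m$2$4))\<^sup>2 + (Im (m$2$4))\<^sup>2"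
  by (simp add: quat_normsq_2 cmod_power2)

lemma quat_normsq_compl_Re_Im:
  "m \<in> USp4 \<Longrightarrow> 1 - quat_normsq m = (Re (m$2$1))\<^sup>2 + (Im (m$2$1))\<^sup>2 + (Re (m$2$3))\<^sup>2 + (Im (m$2$3))\<^sup>2"
  using USp4_norms(1)[of m] by (simp add: quat_normsq_def cmod_power2)

lemma quat_normsq_bounds: "m \<in> USp4 \<Longrightarrow> 0 \<le> quat_normsq m \<and> quat_normsq m \<le> 1"
  using quat_normsq_compl_Re_Im[of m] by (smt (verit) quat_normsq_Re_Im zero_le_power2)

lemma USp4_entry_bounds:
  assumes m: "m \<in> USp4"
  shows "\<bar>Re (m$1$1)\<bar> \<le> 1" "\<bar>Im (m$1$1)\<bar> \<le> 1" "\<bar>Re (m$1$3)\<bar> \<le> 1" "\<bar>Im (m$1$3)\<bar> \<le> 1"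
    "\<bar>Re (m$2$2)\<bar> \<le> 1" "\<bar>Im (m$2$2)\<bar> \<le> 1" "\<bar>Re (m$2$4)\<bar> \<le> 1" "\<bar>Im (m$2$4)\<bar> \<le> 1"
proof -
  have *: "\<bar>y\<bar> \<le> 1" if "y\<^sup>2 \<le> quat_normsq m" for y
    using that quat_normsq_bounds[OF m] abs_square_le_1[of y] by linarith
  show "\<bar>Re (m$1$1)\<bar> \<le> 1" "\<bar>Im (m$1$1)\<bar> \<le> 1" "\<bar>Re (m$1$3)\<bar> \<le> 1" "\<bar>Im (m$1$3)\<bar> \<le> 1"
    by (rule *, simp add: quat_normsq_Re_Im)+
  show "\<bar>Re (m$2$2)\<bar> \<le> 1" "\<bar>Im (m$2$2)\<bar> \<le> 1" "\<bar>Re (m$2$4)\<bar> \<le> 1" "\<bar>Im (m$2$4)\<bar> \<le> 1"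
    by (rule *, simp add: quat_normsq_2_Re_Im[OF m])+
qed

lemma continuous_on_quat_normsq [continuous_intros]: "continuous_on A quat_normsq"
  unfolding quat_normsq_def by (intro continuous_intros)

text \<open>The quaternionic matrix diag(a + b j, 1): for |a|^2 + |b|^2 = 1 it multiplies the first
  quaternionic row by a unit quaternion. Likewise \<open>row2_rot\<close> is diag(1, a + b
  j).\<close>

definition row1_rot :: "complex \<Rightarrow> complex \<Rightarrow> complex^4^4" where
  "row1_rot a b = quat_mat a 0 b 0 0 1 0 0"

definition row2_rot :: "complex \<Rightarrow> complex \<Rightarrow> complex^4^4" where
  "row2_rot a b = quat_mat 1 0 0 0 0 a 0 b"

lemma row_rot_in_USp4:
  assumes "(cmod a)\<^sup>2 + (cmod b)\<^sup>2 = 1"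
  shows "row1_rot a b \<in> USp4" "row2_rot a b \<in> USp4"
proof -
  have "complex_of_real ((cmod a)\<^sup>2 + (cmod b)\<^sup>2) = 1"
    using assms by simp
  then have "a * cnj a + b * cnj b = 1"
    by (simp del: of_real_power add: complex_norm_square)
  then show "row1_rot a b \<in> USp4" "row2_rot a b \<in> USp4"
    unfolding row1_rot_def row2_rot_def by (auto intro!: quat_mat_in_USp4)
qed

lemma row1_rot_nth:
  assumes "m \<in> USp4"
  shows "(row1_rot a b ** m) $ 1 $ 1 = a * m$1$1 - b * cnj (m$1$3)"
    "(row1_rot a b ** m) $ 1 $ 3 = a * m$1$3 + b * cnj (m$1$1)"
    "(row1_rot a b ** m) $ 2 $ 2 = m$2$2"
  by (simp_all add: row1_rot_def quat_mat_mult_nth[OF assms])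

lemma row2_rot_nth:
  assumes "m \<in> USp4"
  shows "(row2_rot a b ** m) $ 2 $ 2 = a * m$2$2 - b * cnj (m$2$4)"
    "(row2_rot a b ** m) $ 2 $ 4 = a * m$2$4 + b * cnj (m$2$2)"
    "(row2_rot a b ** m) $ 1 $ 1 = m$1$1" "(row2_rot a b ** m) $ 1 $ 3 = m$1$3"
  by (simp_all add: row2_rot_def quat_mat_mult_nth[OF assms])

lemma quat_normsq_row_rot:
  assumes m: "m \<in> USp4" and ab: "(cmod a)\<^sup>2 + (cmod b)\<^sup>2 = 1"
  shows "quat_normsq (row1_rot a b ** m) = quat_normsq m" "quat_normsq (row2_rot a b ** m) = quat_normsq m"
proof -
  have "quat_normsq (row1_rot a b ** m) = ((cmod a)\<^sup>2 + (cmod b)\<^sup>2) * quat_normsq m"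
    unfolding quat_normsq_Re_Im row1_rot_nth[OF m] cmod_power2
    by (simp add: power2_eq_square algebra_simps)
  then show "quat_normsq (row1_rot a b ** m) = quat_normsq m" by (simp add: ab)
  show "quat_normsq (row2_rot a b ** m) = quat_normsq m"
    by (simp add: quat_normsq_def row2_rot_nth[OF m])
qed

lemma abs_power_mult_le_1:
  fixes a b :: real
  assumes "\<bar>a\<bar> \<le> 1" "\<bar>b\<bar> \<le> 1"
  shows "\<bar>a ^ i * b ^ j\<bar> \<le> 1"
  using assms by (simp add: abs_mult power_abs mult_le_one power_le_one)

lemma cmod_ii_sin_square [simp]: "(cmod (complex_of_real c + \<i> * complex_of_real s))\<^sup>2 = c\<^sup>2 + s\<^sup>2"
  "(cmod (\<i> * complex_of_real s))\<^sup>2 = s\<^sup>2"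
  by (simp_all add: cmod_power2)

context
  fixes M :: "(complex^4^4) measure"
  assumes haar: "normalized_haar USp4 M"
begin

lemma space_haar: "space M = USp4"
  using haar by (simp add: normalized_haar_def)

lemma prob_space_haar: "prob_space M"
  using haar by (simp add: normalized_haar_def)

lemma haar_integrable:
  fixes F :: "complex^4^4 \<Rightarrow> real"
  assumes "continuous_on UNIV F" "\<And>m. m \<in> USp4 \<Longrightarrow> \<bar>F m\<bar> \<le> C"
  shows "integrable M F"
proof -
  interpret prob_space M by (rule prob_space_haar)
  show ?thesis
    using assms by (intro integrable_const_bound[of _ C]) (auto simp: space_haar normalized_haar_measurable[OF haar])
qed

text \<open>\<open>(B, A1, A2, A3)\<close> are the coordinates of a point on a 3-sphere of radius \<open>sqrt quat_normsq\<close>; summing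
  the three rotation identities eliminates the \<open>A\<close>s.\<close>

lemma haar_sphere3_moment:
  fixes B A1 A2 A3 H :: "complex^4^4 \<Rightarrow> real"
  assumes cont: "continuous_on UNIV B" "continuous_on UNIV A1" "continuous_on UNIV A2" "continuous_on UNIV A3"
      "continuous_on UNIV H"
    and bnd: "\<And>m. m \<in> USp4 \<Longrightarrow> \<bar>B m\<bar> \<le> 1" "\<And>m. m \<in> USp4 \<Longrightarrow> \<bar>H m\<bar> \<le> 1"
    and sq: "\<And>m. m \<in> USp4 \<Longrightarrow> (A1 m)\<^sup>2 + (A2 m)\<^sup>2 + (A3 m)\<^sup>2 = quat_normsq m - (B m)\<^sup>2"
    and rot: "\<And>k A. A \<in> {A1, A2, A3} \<Longrightarrow>
        (\<integral>m. B m * B m ^ k * H m \<partial>M) = k * (\<integral>m. (A m)\<^sup>2 * B m ^ (k - 1) * H m \<partial>M)"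
  shows "(k + 4) * (\<integral>m. B m ^ (k + 2) * H m \<partial>M) = (k + 1) * (\<integral>m. B m ^ k * (quat_normsq m * H m) \<partial>M)"
proof -
  have A: "\<bar>A m\<bar> \<le> 1" if "m \<in> USp4" "A \<in> {A1, A2, A3}" for A m
  proof -
    have "(A m)\<^sup>2 \<le> 1"
      using that sq[OF that(1)] quat_normsq_bounds[OF that(1)]
      by (smt (verit) empty_iff insert_iff zero_le_power2)
    then show ?thesis by (simp add: abs_square_le_1)
  qed
  have int: "integrable M (\<lambda>m. (A m)\<^sup>2 * B m ^ k * H m)" if "A \<in> {A1, A2, A3}" for A
  proof (rule haar_integrable)
    show "continuous_on UNIV (\<lambda>m. (A m)\<^sup>2 * B m ^ k * H m)"
      using that by (auto intro!: continuous_intros cont)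
    show "\<bar>(A m)\<^sup>2 * B m ^ k * H m\<bar> \<le> 1" if m: "m \<in> USp4" for m
      using abs_power_mult_le_1[OF A[OF m \<open>A \<in> _\<close>] bnd(1)[OF m], of 2 k] bnd(2)[OF m]
      by (simp add: abs_mult mult_le_one)
  qed
  have intB: "integrable M (\<lambda>m. B m ^ (k + 2) * H m)"
  proof (rule haar_integrable)
    show "continuous_on UNIV (\<lambda>m. B m ^ (k + 2) * H m)"
      by (auto intro!: continuous_intros cont)
    show "\<bar>B m ^ (k + 2) * H m\<bar> \<le> 1" if m: "m \<in> USp4" for m
      using abs_power_mult_le_1[OF bnd(1)[OF m] bnd(2)[OF m], of "k + 2" 1] by simp
  qed
  have intN: "integrable M (\<lambda>m. B m ^ k * (quat_normsq m * H m))"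
  proof (rule haar_integrable)
    show "continuous_on UNIV (\<lambda>m. B m ^ k * (quat_normsq m * H m))"
      by (auto intro!: continuous_intros cont)
    show "\<bar>B m ^ k * (quat_normsq m * H m)\<bar> \<le> 1" if m: "m \<in> USp4" for m
      using abs_power_mult_le_1[OF bnd(1)[OF m], of "quat_normsq m" k 1] bnd(2)[OF m] quat_normsq_bounds[OF m]
      by (simp add: abs_mult mult_le_one power_le_one bnd(1)[OF m] power_abs)
  qed
  have rot': "(\<integral>m. B m ^ (k + 2) * H m \<partial>M) = (k + 1) * (\<integral>m. (A m)\<^sup>2 * B m ^ k * H m \<partial>M)"
    if "A \<in> {A1, A2, A3}" for A
    using rot[OF that, of "k + 1"] by (simp add: mult.assoc)
  \<comment> \<open>The sphere equation turns the sum of squares into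
    \<open>quat_normsq m - (B m)\<^sup>2\<close>. This subtracts k + 1 copies of the moment on the
    left; moved over, they raise its coefficient from 3 to k + 4.\<close>
  have "3 * (\<integral>m. B m ^ (k + 2) * H m \<partial>M)
      = (k + 1) * ((\<integral>m. (A1 m)\<^sup>2 * B m ^ k * H m \<partial>M) + (\<integral>m. (A2 m)\<^sup>2 * B m ^ k * H m \<partial>M)
                 + (\<integral>m. (A3 m)\<^sup>2 * B m ^ k * H m \<partial>M))"
    using rot'[of A1] rot'[of A2] rot'[of A3] by (simp add: algebra_simps)
  also have "(\<integral>m. (A1 m)\<^sup>2 * B m ^ k * H m \<partial>M) + (\<integral>m. (A2 m)\<^sup>2 * B m ^ k * H m \<partial>M)
                 + (\<integral>m. (A3 m)\<^sup>2 * B m ^ k * H m \<partial>M)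
      = (\<integral>m. (A1 m)\<^sup>2 * B m ^ k * H m + (A2 m)\<^sup>2 * B m ^ k * H m + (A3 m)\<^sup>2 * B m ^ k * H m \<partial>M)"
    using int by (simp add: Bochner_Integration.integral_add)
  also have "\<dots> = (\<integral>m. B m ^ k * (quat_normsq m * H m) - B m ^ (k + 2) * H m \<partial>M)"
  proof (rule Bochner_Integration.integral_cong)
    fix m assume "m \<in> space M"
    then have "quat_normsq m = (A1 m)\<^sup>2 + (A2 m)\<^sup>2 + (A3 m)\<^sup>2 + (B m)\<^sup>2"
      using sq[of m] by (simp add: space_haar)
    then show "(A1 m)\<^sup>2 * B m ^ k * H m + (A2 m)\<^sup>2 * B m ^ k * H m + (A3 m)\<^sup>2 * B m ^ k * H m
        = B m ^ k * (quat_normsq m * H m) - B m ^ (k + 2) * H m"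
      by (simp add: algebra_simps power_add power2_eq_square)
  qed simp
  also have "\<dots> = (\<integral>m. B m ^ k * (quat_normsq m * H m) \<partial>M) - (\<integral>m. B m ^ (k + 2) * H m \<partial>M)"
    using intN intB by (rule Bochner_Integration.integral_diff)
  finally show ?thesis by (simp add: algebra_simps)
qed

lemma haar_rotation_moment_0:
  fixes A B H :: "complex^4^4 \<Rightarrow> real"
  assumes "continuous_on UNIV A" "continuous_on UNIV B" "continuous_on UNIV H"
    and "\<And>m. m \<in> USp4 \<Longrightarrow> \<bar>A m\<bar> \<le> 1"
    and "\<And>m. m \<in> USp4 \<Longrightarrow> \<bar>B m\<bar> \<le> 1"
    and "\<And>m. m \<in> USp4 \<Longrightarrow> \<bar>H m\<bar> \<le> 1"
    and "\<And>t. g t \<in> USp4"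
    and "\<And>t m. m \<in> USp4 \<Longrightarrow> A (g t ** m) = cos t * A m + sin t * B m"
    and "\<And>t m. m \<in> USp4 \<Longrightarrow> B (g t ** m) = cos t * B m - sin t * A m"
    and "\<And>t m. m \<in> USp4 \<Longrightarrow> H (g t ** m) = H m"
  shows "(\<integral>m. B m * B m ^ k * H m \<partial>M) = k * (\<integral>m. (A m)\<^sup>2 * B m ^ (k - 1) * H m \<partial>M)"
  using haar_rotation_moment[OF haar assms, where r = 0 and k = k] by simp

text \<open>Left multiplication of p by exp(i t), cos t + sin t j and cos t + sin t ij rotates Re p
  against each of the other three real coordinates of p. The weight in Re q and |p|^2 is fixed by
  all of them.\<close>

lemma Re11_rot:
  assumes "A \<in> {\<lambda>m. Im (m$1$1), \<lambda>m. Re (m$1$3), \<lambda>m. Im (m$1$3)}"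
  shows "(\<integral>m. Re (m$1$1) * Re (m$1$1) ^ k * (Re (m$2$2) ^ j * quat_normsq m ^ l) \<partial>M)
    = k * (\<integral>m. (A m)\<^sup>2 * Re (m$1$1) ^ (k - 1) * (Re (m$2$2) ^ j * quat_normsq m ^ l) \<partial>M)"
proof -
  have H: "\<bar>Re (m$2$2) ^ j * quat_normsq m ^ l\<bar> \<le> 1" if "m \<in> USp4" for m
    using USp4_entry_bounds[OF that] quat_normsq_bounds[OF that] by (intro abs_power_mult_le_1) auto
  then have H': "\<bar>quat_normsq m ^ l * Re (m$2$2) ^ j\<bar> \<le> 1" if "m \<in> USp4" for m
    using that by (simp add: mult.commute)
  note simps = row1_rot_nth quat_normsq_row_rot row_rot_in_USp4 USp4_entry_bounds
  consider "A = (\<lambda>m. Im (m$1$1))" | "A = (\<lambda>m. Re (m$1$3))" | "A = (\<lambda>m. Im (m$1$3))"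
    using assms by blast
  then show ?thesis
  proof cases
    case 1
    show ?thesis unfolding 1
      by (rule haar_rotation_moment_0[where g = "\<lambda>t. row1_rot (complex_of_real (cos t) + \<i> * complex_of_real (sin t)) 0"])
         (auto intro!: continuous_intros H H' simp: simps algebra_simps)
  next
    case 2
    show ?thesis unfolding 2
      by (rule haar_rotation_moment_0[where g = "\<lambda>t. row1_rot (complex_of_real (cos t)) (complex_of_real (sin t))"])
         (auto intro!: continuous_intros H H' simp: simps algebra_simps)
  next
    case 3
    show ?thesis unfolding 3
      by (rule haar_rotation_moment_0[where g = "\<lambda>t. row1_rot (complex_of_real (cos t)) (\<i> * complex_of_real (sin t))"])
         (auto intro!: continuous_intros H H' simp: simps algebra_simps)
  qed
qed

text \<open>The analogue for q. The weight contains no Re p, because \<open>Re11_moment_even\<close>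
  integrates out Re p first.\<close>

lemma Re22_rot:
  assumes "A \<in> {\<lambda>m. Im (m$2$2), \<lambda>m. Re (m$2$4), \<lambda>m. Im (m$2$4)}"
  shows "(\<integral>m. Re (m$2$2) * Re (m$2$2) ^ k * quat_normsq m ^ l \<partial>M)
    = k * (\<integral>m. (A m)\<^sup>2 * Re (m$2$2) ^ (k - 1) * quat_normsq m ^ l \<partial>M)"
proof -
  have H: "\<bar>quat_normsq m ^ l\<bar> \<le> 1" if "m \<in> USp4" for m
    using quat_normsq_bounds[OF that] by (simp add: power_le_one)
  note simps = row2_rot_nth quat_normsq_row_rot row_rot_in_USp4 USp4_entry_bounds
  consider "A = (\<lambda>m. Im (m$2$2))" | "A = (\<lambda>m. Re (m$2$4))" | "A = (\<lambda>m. Im (m$2$4))"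
    using assms by blast
  then show ?thesis
  proof cases
    case 1
    show ?thesis unfolding 1
      by (rule haar_rotation_moment_0[where g = "\<lambda>t. row2_rot (complex_of_real (cos t) + \<i> * complex_of_real (sin t)) 0"])
         (auto intro!: continuous_intros H simp: simps algebra_simps)
  next
    case 2
    show ?thesis unfolding 2
      by (rule haar_rotation_moment_0[where g = "\<lambda>t. row2_rot (complex_of_real (cos t)) (complex_of_real (sin t))"])
         (auto intro!: continuous_intros H simp: simps algebra_simps)
  next
    case 3
    show ?thesis unfolding 3
      by (rule haar_rotation_moment_0[where g = "\<lambda>t. row2_rot (complex_of_real (cos t)) (\<i> * complex_of_real (sin t))"])
         (auto intro!: continuous_intros H simp: simps algebra_simps)
  qed
qed

lemma Re11_moment_recurrence:
  "(k + 4) * (\<integral>m. Re (m$1$1) ^ (k + 2) * (Re (m$2$2) ^ j * quat_normsq m ^ l) \<partial>M)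
    = (k + 1) * (\<integral>m. Re (m$1$1) ^ k * (Re (m$2$2) ^ j * quat_normsq m ^ Suc l) \<partial>M)"
proof -
  have H: "\<bar>Re (m$2$2) ^ j * quat_normsq m ^ l\<bar> \<le> 1" if "m \<in> USp4" for m
    using USp4_entry_bounds[OF that] quat_normsq_bounds[OF that] by (intro abs_power_mult_le_1) auto
  show ?thesis
    using haar_sphere3_moment[where B = "\<lambda>m. Re (m$1$1)" and ?A1.0 = "\<lambda>m. Im (m$1$1)"
        and ?A2.0 = "\<lambda>m. Re (m$1$3)" and ?A3.0 = "\<lambda>m. Im (m$1$3)"
        and H = "\<lambda>m. Re (m$2$2) ^ j * quat_normsq m ^ l", OF _ _ _ _ _ USp4_entry_bounds(1) H _ Re11_rot, where k = k]
    by (simp add: continuous_intros quat_normsq_Re_Im algebra_simps)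
qed

lemma Re22_moment_recurrence:
  "(k + 4) * (\<integral>m. Re (m$2$2) ^ (k + 2) * quat_normsq m ^ l \<partial>M)
    = (k + 1) * (\<integral>m. Re (m$2$2) ^ k * quat_normsq m ^ Suc l \<partial>M)"
proof -
  have H: "\<bar>quat_normsq m ^ l\<bar> \<le> 1" if "m \<in> USp4" for m
    using quat_normsq_bounds[OF that] by (simp add: power_le_one)
  show ?thesis
    using haar_sphere3_moment[where B = "\<lambda>m. Re (m$2$2)" and ?A1.0 = "\<lambda>m. Im (m$2$2)"
        and ?A2.0 = "\<lambda>m. Re (m$2$4)" and ?A3.0 = "\<lambda>m. Im (m$2$4)"
        and H = "\<lambda>m. quat_normsq m ^ l", OF _ _ _ _ _ USp4_entry_bounds(5) H _ Re22_rot, where k = k]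
    by (simp add: continuous_intros quat_normsq_2_Re_Im algebra_simps)
qed

end

section \<open>Rotations mixing the rows\<close>

text \<open>Left multiplication by \<open>(cos t, sin t * e; - sin t * conj e, cos t)\<close> for the unit quaternion
  \<open>e = a + b j\<close>. It rotates \<open>(\<bar>p\<bar>\<^sup>2 - 1/2, \<langle>p, e w\<rangle>)\<close> by the angle \<open>2 t\<close>; with \<open>e\<close> running over \<open>1, i, j, ij\<close>,
  these are the coordinates of the Hopf map from the 7-sphere to the 4-sphere.\<close>

definition mix_rot :: "complex \<Rightarrow> complex \<Rightarrow> real \<Rightarrow> complex^4^4" where
  "mix_rot a b t = quat_mat (of_real (cos t)) (of_real (sin t) * a) 0 (of_real (sin t) * b)
      (- (of_real (sin t) * cnj a)) (of_real (cos t)) (of_real (sin t) * b) 0"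

text \<open>The product e w is expanded with j z = cnj z j and j^2 = -1 before pairing with
  p.\<close>

definition mix_inner :: "complex \<Rightarrow> complex \<Rightarrow> complex^4^4 \<Rightarrow> real" where
  "mix_inner a b m = Re (m$1$1 * cnj (a * m$2$1 - b * cnj (m$2$3)))
     + Re (m$1$3 * cnj (a * m$2$3 + b * cnj (m$2$1)))"

definition quat_units :: "(complex \<times> complex) set" where
  "quat_units = {(1, 0), (\<i>, 0), (0, 1), (0, \<i>)}"

lemma quat_unitsE:
  assumes "(a, b) \<in> quat_units"
  obtains "a = 1" "b = 0" | "a = \<i>" "b = 0" | "a = 0" "b = 1" | "a = 0" "b = \<i>"
  using assms by (auto simp: quat_units_def)

lemma continuous_on_mix_inner [continuous_intros]: "continuous_on A (mix_inner a b)"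
  unfolding mix_inner_def by (intro continuous_intros)

lemma mix_rot_in_USp4:
  assumes "(a, b) \<in> quat_units"
  shows "mix_rot a b t \<in> USp4"
proof -
  have 1: "complex_of_real (cos t) * of_real (cos t) + of_real (sin t) * of_real (sin t) = 1"
    by (simp flip: of_real_mult of_real_add of_real_power add: power2_eq_square[symmetric])
  show ?thesis
    unfolding mix_rot_def using assms 1
    by (elim quat_unitsE) (auto intro!: quat_mat_in_USp4 simp del: cos_of_real sin_of_real simp: algebra_simps)
qed

lemma mix_rot_nth:
  assumes "m \<in> USp4"
  shows "(mix_rot a b t ** m) $ 1 $ 1
      = of_real (cos t) * m$1$1 + of_real (sin t) * (a * m$2$1 - b * cnj (m$2$3))"
    "(mix_rot a b t ** m) $ 1 $ 3
      = of_real (cos t) * m$1$3 + of_real (sin t) * (a * m$2$3 + b * cnj (m$2$1))"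
    "(mix_rot a b t ** m) $ 2 $ 1
      = of_real (cos t) * m$2$1 - of_real (sin t) * (cnj a * m$1$1 + b * cnj (m$1$3))"
    "(mix_rot a b t ** m) $ 2 $ 3
      = of_real (cos t) * m$2$3 - of_real (sin t) * (cnj a * m$1$3 - b * cnj (m$1$1))"
  unfolding mix_rot_def quat_mat_mult_nth[OF assms] by (simp_all add: algebra_simps)

text \<open>This expands |cos t p + sin t e w|^2, using |e w|^2 = |w|^2 = 1 - |p|^2.\<close>

lemma quat_normsq_mix_rot:
  assumes m: "m \<in> USp4" and ab: "(a, b) \<in> quat_units"
  shows "quat_normsq (mix_rot a b t ** m)
      = (cos t)\<^sup>2 * quat_normsq m + 2 * cos t * sin t * mix_inner a b m + (sin t)\<^sup>2 * (1 - quat_normsq m)"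
  unfolding quat_normsq_compl_Re_Im[OF m] using ab
  by (elim quat_unitsE)
     (simp_all add: quat_normsq_Re_Im mix_rot_nth[OF m] mix_inner_def power2_eq_square algebra_simps)

text \<open>The new w is w' = cos t w - sin t conj(e) p, so e w' = cos t e w - sin t p, to be paired
  with cos t p + sin t e w.\<close>

lemma mix_inner_mix_rot:
  assumes m: "m \<in> USp4" and ab: "(a, b) \<in> quat_units"
  shows "mix_inner a b (mix_rot a b t ** m)
      = ((cos t)\<^sup>2 - (sin t)\<^sup>2) * mix_inner a b m + cos t * sin t * ((1 - quat_normsq m) - quat_normsq m)"
  unfolding quat_normsq_compl_Re_Im[OF m] using ab
  by (elim quat_unitsE)
     (simp_all add: quat_normsq_Re_Im mix_rot_nth[OF m] mix_inner_def power2_eq_square algebra_simps)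

text \<open>The four inner products are the coordinates of p conj(w) in the orthonormal basis 1, i,
  j, ij, and the quaternion norm is multiplicative.\<close>

lemma sum_mix_inner_square:
  assumes m: "m \<in> USp4"
  shows "(mix_inner 1 0 m)\<^sup>2 + (mix_inner \<i> 0 m)\<^sup>2 + (mix_inner 0 1 m)\<^sup>2 + (mix_inner 0 \<i> m)\<^sup>2
    = quat_normsq m * (1 - quat_normsq m)"
  unfolding quat_normsq_compl_Re_Im[OF m]
  by (simp add: quat_normsq_Re_Im mix_inner_def power2_eq_square algebra_simps)

lemma abs_mix_inner_le:
  assumes m: "m \<in> USp4" and ab: "(a, b) \<in> quat_units"
  shows "\<bar>mix_inner a b m\<bar> \<le> 1"
proof -
  have "quat_normsq m * (1 - quat_normsq m) \<le> 1"
    using quat_normsq_bounds[OF m] by (intro mult_le_one) auto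
  then have "(mix_inner a b m)\<^sup>2 \<le> 1"
    using ab sum_mix_inner_square[OF m] zero_le_power2[of "mix_inner 1 0 m"] zero_le_power2[of "mix_inner \<i> 0 m"]
      zero_le_power2[of "mix_inner 0 1 m"] zero_le_power2[of "mix_inner 0 \<i> m"]
    by (elim quat_unitsE; hypsubst; linarith)
  then show ?thesis by (simp add: abs_square_le_1)
qed

context
  fixes M :: "(complex^4^4) measure"
  assumes haar: "normalized_haar USp4 M"
begin

lemma mix_moment:
  assumes ab: "(a, b) \<in> quat_units"
  shows "(\<integral>m. (quat_normsq m - 1/2) * quat_normsq m ^ k \<partial>M) = k * (\<integral>m. (mix_inner a b m)\<^sup>2 * quat_normsq m ^ (k - 1) \<partial>M)"
proof -
  have "(\<integral>m. (quat_normsq m - 1/2) * ((quat_normsq m - 1/2) + 1/2) ^ k * 1 \<partial>M)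
      = k * (\<integral>m. (mix_inner a b m)\<^sup>2 * ((quat_normsq m - 1/2) + 1/2) ^ (k - 1) * 1 \<partial>M)"
  \<comment> \<open>The coordinates turn by twice the angle of \<open>mix_rot\<close>, hence the
    half; the minus sign gives the orientation that \<open>haar_rotation_moment\<close> expects.
    Centring at 1/2, where |p|^2 = |w|^2, makes the action linear.\<close>
  proof (rule haar_rotation_moment[OF haar, where g = "\<lambda>t. mix_rot a b (- (t/2))"])
    fix t :: real
    have ct: "cos t = (cos (t/2))\<^sup>2 - (sin (t/2))\<^sup>2" and st: "sin t = 2 * sin (t/2) * cos (t/2)"
      using cos_double[of "t/2"] sin_double[of "t/2"] by simp_all
    have one: "(cos (t/2))\<^sup>2 = 1 - (sin (t/2))\<^sup>2" by (simp add: cos_squared_eq)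
    show "mix_inner a b (mix_rot a b (- (t/2)) ** m) = cos t * mix_inner a b m + sin t * (quat_normsq m - 1/2)"
      if "m \<in> USp4" for m
      unfolding mix_inner_mix_rot[OF that ab] ct st by (simp add: algebra_simps)
    show "quat_normsq (mix_rot a b (- (t/2)) ** m) - 1/2 = cos t * (quat_normsq m - 1/2) - sin t * mix_inner a b m"
      if "m \<in> USp4" for m
      unfolding quat_normsq_mix_rot[OF that ab] ct st cos_minus sin_minus power2_minus one by (simp add: algebra_simps)
    show "\<bar>quat_normsq m - 1 / 2\<bar> \<le> 1" if "m \<in> USp4" for m
      using quat_normsq_bounds[OF that] by auto
  qed (auto intro!: continuous_intros mix_rot_in_USp4 abs_mix_inner_le ab)
  then show ?thesis by simp
qed

lemma quat_normsq_power_integrable: "integrable M (\<lambda>m. quat_normsq m ^ k)"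
  using quat_normsq_bounds by (intro haar_integrable[OF haar, of _ 1] continuous_intros) (simp add: power_le_one)

text \<open>Write I_k for the k-th moment. Adding \<open>mix_moment\<close> over the four units and
  inserting \<open>sum_mix_inner_square\<close> gives 4 (I_(k+1) - I_k / 2) = k (I_k -
  I_(k+1)).\<close>

lemma quat_normsq_moment_recurrence:
  "(k + 4) * (\<integral>m. quat_normsq m ^ Suc k \<partial>M) = (k + 2) * (\<integral>m. quat_normsq m ^ k \<partial>M)"
proof -
  let ?D = "\<lambda>a b m. (mix_inner a b m)\<^sup>2 * quat_normsq m ^ (k - 1)"
  have int: "integrable M (?D a b)" if "(a, b) \<in> quat_units" for a b
  proof (rule haar_integrable[OF haar])
    show "continuous_on UNIV (?D a b)" by (intro continuous_intros)
    show "\<bar>?D a b m\<bar> \<le> 1" if "m \<in> USp4" for m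
      using abs_mix_inner_le[OF that \<open>(a, b) \<in> quat_units\<close>] quat_normsq_bounds[OF that]
      by (intro abs_power_mult_le_1) auto
  qed
  have u: "(1, 0) \<in> quat_units" "(\<i>, 0) \<in> quat_units" "(0, 1) \<in> quat_units" "(0, \<i>) \<in> quat_units"
    by (simp_all add: quat_units_def)
  have "4 * (\<integral>m. (quat_normsq m - 1/2) * quat_normsq m ^ k \<partial>M)
    = k * ((\<integral>m. ?D 1 0 m \<partial>M) + (\<integral>m. ?D \<i> 0 m \<partial>M) + (\<integral>m. ?D 0 1 m \<partial>M) + (\<integral>m. ?D 0 \<i> m \<partial>M))"
    using mix_moment[OF u(1), of k] mix_moment[OF u(2), of k] mix_moment[OF u(3), of k]
      mix_moment[OF u(4), of k]
    unfolding distrib_left by linarith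
  also have "(\<integral>m. ?D 1 0 m \<partial>M) + (\<integral>m. ?D \<i> 0 m \<partial>M) + (\<integral>m. ?D 0 1 m \<partial>M) + (\<integral>m. ?D 0 \<i> m \<partial>M)
    = (\<integral>m. ?D 1 0 m + ?D \<i> 0 m + ?D 0 1 m + ?D 0 \<i> m \<partial>M)"
    using int by (simp add: quat_units_def)
  also have "\<dots> = (\<integral>m. quat_normsq m * (1 - quat_normsq m) * quat_normsq m ^ (k - 1) \<partial>M)"
    by (rule Bochner_Integration.integral_cong)
       (simp_all add: space_haar[OF haar] flip: sum_mix_inner_square distrib_right)
  \<comment> \<open>The factor \<open>k\<close> has to stay: at \<open>k = 0\<close> the exponent
    \<open>k - 1\<close> truncates, and the two sides agree only because both are 0.\<close>
  also have "k * \<dots> = k * (\<integral>m. quat_normsq m ^ k - quat_normsq m ^ Suc k \<partial>M)"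
    by (cases k) (simp_all add: algebra_simps)
  also have "(\<integral>m. quat_normsq m ^ k - quat_normsq m ^ Suc k \<partial>M) = (\<integral>m. quat_normsq m ^ k \<partial>M) - (\<integral>m. quat_normsq m ^ Suc k \<partial>M)"
    by (intro Bochner_Integration.integral_diff quat_normsq_power_integrable)
  also have "(\<integral>m. (quat_normsq m - 1/2) * quat_normsq m ^ k \<partial>M) = (\<integral>m. quat_normsq m ^ Suc k - 1/2 * quat_normsq m ^ k \<partial>M)"
    by (simp add: algebra_simps)
  also have "\<dots> = (\<integral>m. quat_normsq m ^ Suc k \<partial>M) - 1/2 * (\<integral>m. quat_normsq m ^ k \<partial>M)"
    using quat_normsq_power_integrable[of k] quat_normsq_power_integrable[of "Suc k"]
    by (subst Bochner_Integration.integral_diff) simp_all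
  finally show ?thesis by (simp add: algebra_simps)
qed

text \<open>These are the moments of the density 6 x (1 - x) on [0, 1], the Beta(2, 2) law.\<close>

lemma quat_normsq_moment: "(\<integral>m. quat_normsq m ^ k \<partial>M) = 6 / ((real k + 2) * (real k + 3))"
proof (induction k)
  case 0
  interpret prob_space M by (rule prob_space_haar[OF haar])
  show ?case by (simp add: prob_space)
next
  case (Suc k)
  have "(\<integral>m. quat_normsq m ^ Suc k \<partial>M) = (k + 2) * (\<integral>m. quat_normsq m ^ k \<partial>M) / (k + 4)"
    using quat_normsq_moment_recurrence[of k] by (simp add: eq_divide_eq mult.commute del: power_Suc)
  also have "\<dots> = (k + 2) * (6 / ((real k + 2) * (real k + 3))) / (k + 4)"
    by (simp only: Suc.IH)
  also have "\<dots> = 6 / ((real (Suc k) + 2) * (real (Suc k) + 3))"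
    by (simp add: divide_simps) (simp add: algebra_simps)
  finally show ?case .
qed

end

section \<open>Moments of the trace\<close>

text \<open>The moment of order 2 j of the semicircle law on [-1, 1], which is the law of one
  coordinate on the unit 3-sphere: a Catalan number divided by 4^j.\<close>

definition semicircle_moment :: "nat \<Rightarrow> real" where
  "semicircle_moment j = fact (2 * j) / (4 ^ j * fact j * fact (j + 1))"

lemma semicircle_moment_0 [simp]: "semicircle_moment 0 = 1"
  by (simp add: semicircle_moment_def)

lemma semicircle_moment_Suc: "(2 * j + 4) * semicircle_moment (Suc j) = (2 * j + 1) * semicircle_moment j"
  by (simp add: semicircle_moment_def divide_simps) (simp add: algebra_simps)

text \<open>In factorials each summand is a constant times (n choose j) (n + 2 choose n + 1 - j), so
  Vandermonde yields the central binomial coefficient of 2 n + 2.\<close>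

lemma sum_semicircle_moments:
  "(\<Sum>j\<le>n. ((2 * n) choose (2 * j)) * semicircle_moment j * semicircle_moment (n - j))
    = fact (2 * n) * fact (2 * n + 2) / (4 ^ n * fact n * fact (n + 2) * (fact (n + 1))\<^sup>2)"
proof -
  have "(\<Sum>j\<le>n. ((2 * n) choose (2 * j)) * semicircle_moment j * semicircle_moment (n - j))
    = (\<Sum>j\<le>n. fact (2 * n) / (4 ^ n * fact n * fact (n + 2)) * real ((n choose j) * (n + 2 choose (n + 1 - j))))"
  proof (rule sum.cong)
    fix j assume "j \<in> {..n}"
    then obtain i where n: "n = j + i" by (auto simp: le_iff_add)
    have 1: "real (2 * n choose (2 * j)) = fact (2 * n) / (fact (2 * j) * fact (2 * i))"
      by (subst binomial_fact) (simp_all add: n)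
    have 2: "real (n choose j) = fact n / (fact j * fact i)"
      by (subst binomial_fact) (simp_all add: n)
    have 3: "real (n + 2 choose (n + 1 - j)) = fact (n + 2) / (fact (i + 1) * fact (j + 1))"
    proof -
      have "n + 1 - j = i + 1" "n + 2 - (i + 1) = j + 1" "i + 1 \<le> n + 2" by (simp_all add: n)
      then show ?thesis by (simp only: binomial_fact)
    qed
    have 4: "n - j = i" "(4::real) ^ n = 4 ^ j * 4 ^ i" by (simp_all add: n power_add)
    show "real (2 * n choose (2 * j)) * semicircle_moment j * semicircle_moment (n - j)
        = fact (2 * n) / (4 ^ n * fact n * fact (n + 2)) * real ((n choose j) * (n + 2 choose (n + 1 - j)))"
      unfolding of_nat_mult 1 2 3 4 semicircle_moment_def
      by (simp del: fact_Suc add: divide_simps) 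
  qed simp
  also have "\<dots> = fact (2 * n) / (4 ^ n * fact n * fact (n + 2)) * real (\<Sum>j\<le>n. (n choose j) * (n + 2 choose (n + 1 - j)))"
    by (simp add: sum_distrib_left)
  \<comment> \<open>The added term j = n + 1 is 0, since (n choose n + 1) = 0; it completes the
    range that \<open>vandermonde\<close> needs.\<close>
  also have "(\<Sum>j\<le>n. (n choose j) * (n + 2 choose (n + 1 - j))) = (\<Sum>j\<le>n + 1. (n choose j) * (n + 2 choose (n + 1 - j)))"
    by simp
  also have "\<dots> = (n + (n + 2)) choose (n + 1)"
    by (rule vandermonde)
  also have "real \<dots> = fact (2 * n + 2) / (fact (n + 1))\<^sup>2"
    by (subst binomial_fact) (simp_all add: power2_eq_square mult_2 del: fact_Suc)
  finally show ?thesis by (simp add: divide_simps del: fact_Suc)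
qed

lemma sum_atMost_even:
  fixes f :: "nat \<Rightarrow> 'a::comm_monoid_add"
  assumes "\<And>k. odd k \<Longrightarrow> f k = 0"
  shows "(\<Sum>k\<le>2 * n. f k) = (\<Sum>j\<le>n. f (2 * j))"
  using assms by (induction n) auto

context
  fixes M :: "(complex^4^4) measure"
  assumes haar: "normalized_haar USp4 M"
begin

text \<open>Each use of the recurrence trades two powers of Re p for one power of |p|^2, which is
  why \<open>l\<close> varies in the induction.\<close>

lemma Re11_moment_even:
  "(\<integral>m. Re (m$1$1) ^ (2 * i) * (Re (m$2$2) ^ j * quat_normsq m ^ l) \<partial>M)
    = semicircle_moment i * (\<integral>m. Re (m$2$2) ^ j * quat_normsq m ^ (l + i) \<partial>M)"
proof (induction i arbitrary: l)
  case (Suc i)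
  have "(2 * i + 4) * (\<integral>m. Re (m$1$1) ^ (2 * i + 2) * (Re (m$2$2) ^ j * quat_normsq m ^ l) \<partial>M)
    = (2 * i + 4) * (semicircle_moment (Suc i) * (\<integral>m. Re (m$2$2) ^ j * quat_normsq m ^ (l + Suc i) \<partial>M))"
    using Re11_moment_recurrence[OF haar, of "2 * i" j l] Suc[of "Suc l"]
    by (simp add: semicircle_moment_Suc flip: mult.assoc)
  then show ?case by simp
qed simp

lemma Re11_moment_odd: "(\<integral>m. Re (m$1$1) ^ (2 * i + 1) * (Re (m$2$2) ^ j * quat_normsq m ^ l) \<partial>M) = 0"
proof (induction i arbitrary: l)
  case 0
  \<comment> \<open>At exponent 0 the right-hand side of \<open>Re11_rot\<close> has the factor
    0.\<close>
  show ?case using Re11_rot[OF haar, of "\<lambda>m. Im (m$1$1)" 0] by simp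
next
  case (Suc i)
  then show ?case
    using Re11_moment_recurrence[OF haar, of "2 * i + 1" j l] Suc[of "Suc l"] by simp
qed

lemma Re22_moment_even:
  "(\<integral>m. Re (m$2$2) ^ (2 * i) * quat_normsq m ^ l \<partial>M) = semicircle_moment i * (\<integral>m. quat_normsq m ^ (l + i) \<partial>M)"
proof (induction i arbitrary: l)
  case (Suc i)
  have "(2 * i + 4) * (\<integral>m. Re (m$2$2) ^ (2 * i + 2) * quat_normsq m ^ l \<partial>M)
    = (2 * i + 4) * (semicircle_moment (Suc i) * (\<integral>m. quat_normsq m ^ (l + Suc i) \<partial>M))"
    using Re22_moment_recurrence[OF haar, of "2 * i" l] Suc[of "Suc l"]
    by (simp add: semicircle_moment_Suc flip: mult.assoc)
  then show ?case by simp
qed simp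

lemma Re22_moment_odd: "(\<integral>m. Re (m$2$2) ^ (2 * i + 1) * quat_normsq m ^ l \<partial>M) = 0"
proof (induction i arbitrary: l)
  case 0
  show ?case using Re22_rot[OF haar, of "\<lambda>m. Im (m$2$2)" 0] by simp
next
  case (Suc i)
  then show ?case
    using Re22_moment_recurrence[OF haar, of "2 * i + 1" l] Suc[of "Suc l"] by simp
qed

text \<open>The factor \<open>quat_normsq m ^ 0\<close> keeps the integrands in the shape of
  \<open>Re11_moment_even\<close> and \<open>Re11_moment_odd\<close>.\<close>

lemma tau_moment_sum:
  "(\<integral>m. tau m ^ n \<partial>M) = 2 ^ n * (\<Sum>k\<le>n. (n choose k) * (\<integral>m. Re (m$1$1) ^ k * (Re (m$2$2) ^ (n - k) * quat_normsq m ^ 0) \<partial>M))"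
proof -
  have "(\<integral>m. tau m ^ n \<partial>M)
      = (\<integral>m. 2 ^ n * (\<Sum>k\<le>n. (n choose k) * (Re (m$1$1) ^ k * (Re (m$2$2) ^ (n - k) * quat_normsq m ^ 0))) \<partial>M)"
  proof (rule Bochner_Integration.integral_cong)
    fix m assume "m \<in> space M"
    then have "tau m ^ n = 2 ^ n * (Re (m$1$1) + Re (m$2$2)) ^ n"
      by (simp add: USp4_tau space_haar[OF haar] flip: power_mult_distrib)
    then show "tau m ^ n = 2 ^ n * (\<Sum>k\<le>n. (n choose k) * (Re (m$1$1) ^ k * (Re (m$2$2) ^ (n - k) * quat_normsq m ^ 0)))"
      by (simp add: binomial_ring mult.assoc)
  qed simp
  also have "\<dots> = 2 ^ n * (\<integral>m. (\<Sum>k\<le>n. (n choose k) * (Re (m$1$1) ^ k * (Re (m$2$2) ^ (n - k) * quat_normsq m ^ 0))) \<partial>M)"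
    by simp
  also have "(\<integral>m. (\<Sum>k\<le>n. (n choose k) * (Re (m$1$1) ^ k * (Re (m$2$2) ^ (n - k) * quat_normsq m ^ 0))) \<partial>M)
      = (\<Sum>k\<le>n. \<integral>m. (n choose k) * (Re (m$1$1) ^ k * (Re (m$2$2) ^ (n - k) * quat_normsq m ^ 0)) \<partial>M)"
  proof (rule Bochner_Integration.integral_sum)
    fix k
    have "integrable M (\<lambda>m. Re (m$1$1) ^ k * (Re (m$2$2) ^ (n - k) * quat_normsq m ^ 0))"
      using USp4_entry_bounds
      by (intro haar_integrable[OF haar, of _ 1] continuous_intros) (simp add: abs_power_mult_le_1)
    then show "integrable M (\<lambda>m. (n choose k) * (Re (m$1$1) ^ k * (Re (m$2$2) ^ (n - k) * quat_normsq m ^ 0)))"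
      by simp
  qed
  finally show ?thesis by simp
qed

text \<open>One of k and n - k is odd, so every term of the binomial expansion integrates to
  0.\<close>

lemma tau_moment_odd:
  assumes "odd n"
  shows "(\<integral>m. tau m ^ n \<partial>M) = 0"
proof -
  have "(\<integral>m. Re (m$1$1) ^ k * (Re (m$2$2) ^ (n - k) * quat_normsq m ^ 0) \<partial>M) = 0" if "k \<le> n" for k
  proof (cases "even k")
    case False
    then obtain i where i: "k = 2 * i + 1" by (rule oddE)
    show ?thesis
      using Re11_moment_odd[of i "n - k" 0] unfolding i .
  next
    case True
    then obtain i where i: "k = 2 * i" by blast
    have "odd (n - k)" using assms True that by simp
    then obtain j where j: "n - k = 2 * j + 1" by (rule oddE)
    show ?thesis
      using Re11_moment_even[of i "2 * j + 1" 0] Re22_moment_odd[of j "0 + i"] by (simp only: j) (simp add: i)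
  qed
  then show ?thesis by (simp add: tau_moment_sum)
qed

text \<open>Odd k drop out. For k = 2 j, integrating out Re p and then Re q leaves two semicircle
  moments and the n-th moment of |p|^2. The latter is the same for all j, so
  \<open>sum_semicircle_moments\<close> applies.\<close>

lemma tau_moment_even:
  "(\<integral>m. tau m ^ (2 * n) \<partial>M)
    = 6 * fact (2 * n) * fact (2 * n + 2) / (fact n * fact (n + 1) * fact (n + 2) * fact (n + 3))"
proof -
  let ?f = "\<lambda>k. (2 * n choose k) * (\<integral>m. Re (m$1$1) ^ k * (Re (m$2$2) ^ (2 * n - k) * quat_normsq m ^ 0) \<partial>M)"
  have "?f k = 0" if odd: "odd k" for k
  proof -
    obtain i where i: "k = 2 * i + 1" using odd by (rule oddE)
    show ?thesis
      using Re11_moment_odd[of i "2 * n - k" 0] unfolding i by (simp only: mult_zero_right)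
  qed
  then have "(\<Sum>k\<le>2 * n. ?f k) = (\<Sum>j\<le>n. ?f (2 * j))"
    by (rule sum_atMost_even)
  also have "\<dots> = (\<Sum>j\<le>n. ((2 * n) choose (2 * j)) * semicircle_moment j * semicircle_moment (n - j) * (6 / ((real n + 2) * (real n + 3))))"
  proof (rule sum.cong)
    fix j assume j: "j \<in> {..n}"
    have "(\<integral>m. Re (m$1$1) ^ (2 * j) * (Re (m$2$2) ^ (2 * n - 2 * j) * quat_normsq m ^ 0) \<partial>M)
      = semicircle_moment j * semicircle_moment (n - j) * (6 / ((real n + 2) * (real n + 3)))"
      using Re11_moment_even[of j "2 * (n - j)" 0] Re22_moment_even[of "n - j" j] quat_normsq_moment[OF haar, of n] j
      by (simp add: diff_mult_distrib2)
    then show "?f (2 * j) = ((2 * n) choose (2 * j)) * semicircle_moment j * semicircle_moment (n - j) * (6 / ((real n + 2) * (real n + 3)))"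
      by (simp add: mult.assoc)
  qed simp
  also have "\<dots> = fact (2 * n) * fact (2 * n + 2) / (4 ^ n * fact n * fact (n + 2) * (fact (n + 1))\<^sup>2) * (6 / ((real n + 2) * (real n + 3)))"
    by (simp only: sum_semicircle_moments flip: sum_distrib_right)
  finally have "(\<integral>m. tau m ^ (2 * n) \<partial>M)
      = 2 ^ (2 * n) * (fact (2 * n) * fact (2 * n + 2) / (4 ^ n * fact n * fact (n + 2) * (fact (n + 1))\<^sup>2) * (6 / ((real n + 2) * (real n + 3))))"
    by (simp only: tau_moment_sum)
  also have "\<dots> = 6 * fact (2 * n) * fact (2 * n + 2) / (fact n * fact (n + 1) * fact (n + 2) * fact (n + 3))"
  proof -
    have 1: "(fact (n + 3) :: real) = (real n + 3) * ((real n + 2) * fact (n + 1))"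
      by (simp add: numeral_3_eq_3 algebra_simps)
    have 2: "(2::real) ^ (2 * n) = 4 ^ n" by (simp add: power_mult)
    define a b :: real where "a = real n + 2" and "b = real n + 3"
    have "a > 0" "b > 0" by (simp_all add: a_def b_def)
    then show ?thesis
      unfolding 1 2 a_def[symmetric] b_def[symmetric]
      by (simp add: divide_simps power2_eq_square del: fact_Suc)
  qed
  finally show ?thesis .
qed

end

section \<open>The candidate density and its moments\<close>

text \<open>At \<open>t = 0\<close> the division by zero gives the value 0, which is also the limit.\<close>

definition trace_kernel :: "real \<Rightarrow> real \<Rightarrow> real" where
  "trace_kernel u t = (sqrt (max 0 (t\<^sup>2 - u\<^sup>2)) * sqrt (1 - t\<^sup>2)) ^ 3 / t\<^sup>2"

lemma trace_kernel_eq_0: "\<bar>t\<bar> \<le> \<bar>u\<bar> \<Longrightarrow> trace_kernel u t = 0"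
  by (simp add: trace_kernel_def abs_le_square_iff max_def)

text \<open>The first root is at most t and the second at most 1, so the cube divided by t^2 is at
  most t. This gives continuity of the kernel along t = 0.\<close>

lemma abs_trace_kernel_le:
  assumes "t \<in> {0..1}"
  shows "\<bar>trace_kernel u t\<bar> \<le> t"
proof -
  have 1: "sqrt (max 0 (t\<^sup>2 - u\<^sup>2)) \<le> t"
    using assms by (intro real_le_lsqrt) auto
  have 2: "sqrt (1 - t\<^sup>2) \<le> 1" by simp
  have nn: "0 \<le> sqrt (max 0 (t\<^sup>2 - u\<^sup>2))" "0 \<le> sqrt (1 - t\<^sup>2)"
    using assms by (auto simp: power_le_one)
  have "sqrt (max 0 (t\<^sup>2 - u\<^sup>2)) * sqrt (1 - t\<^sup>2) \<le> t * 1"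
    using 1 2 nn assms by (intro mult_mono) auto
  then have "(sqrt (max 0 (t\<^sup>2 - u\<^sup>2)) * sqrt (1 - t\<^sup>2)) ^ 3 \<le> t ^ 3"
    using nn by (intro power_mono) auto
  then have "trace_kernel u t \<le> t"
    using assms by (cases "t = 0") (auto simp: trace_kernel_def divide_le_eq power3_eq_cube power2_eq_square)
  moreover have "trace_kernel u t \<ge> 0"
    using nn by (simp add: trace_kernel_def)
  ultimately show ?thesis by simp
qed

lemma continuous_on_trace_kernel:
  "continuous_on ({0..1} \<times> {0..1}) (\<lambda>(u, t). trace_kernel u t)"
  unfolding continuous_on_eq_continuous_within
proof
  fix p :: "real \<times> real" assume p: "p \<in> {0..1} \<times> {0..1}"
  show "continuous (at p within {0..1} \<times> {0..1}) (\<lambda>(u, t). trace_kernel u t)"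
  proof (cases "snd p = 0")
    case True
    have "((\<lambda>q. trace_kernel (fst q) (snd q)) \<longlongrightarrow> 0) (at p within {0..1} \<times> {0..1})"
    proof (rule Lim_null_comparison)
      show "\<forall>\<^sub>F q in at p within {0..1} \<times> {0..1}. norm (trace_kernel (fst q) (snd q)) \<le> snd q"
        unfolding eventually_at_filter by (rule always_eventually) (auto intro!: abs_trace_kernel_le)
      show "(snd \<longlongrightarrow> 0) (at p within {0..1} \<times> {0..1})"
        using tendsto_snd[OF tendsto_ident_at[of p "{0..1} \<times> {0..1}"]] True by simp
    qed
    then show ?thesis
      using True by (simp add: continuous_within case_prod_unfold trace_kernel_def)
  next
    case False
    then show ?thesis
      unfolding split_beta trace_kernel_def by (intro continuous_intros) auto
  qed
qed

text \<open>The clipping by \<open>max 0\<close> in \<open>trace_kernel\<close> removes the part t <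
  u, so the range of integration does not depend on u. Continuity in u and the exchange of integrals
  then follow from joint continuity.\<close>

definition trace_profile :: "real \<Rightarrow> real" where
  "trace_profile u = integral {0..1} (trace_kernel u)"

lemma continuous_on_trace_profile: "continuous_on {0..1} trace_profile"
proof -
  have "continuous_on {0..1} (\<lambda>u. integral (cbox 0 1) (trace_kernel u))"
    by (rule integral_continuous_on_param) (use continuous_on_trace_kernel in simp)
  then show ?thesis by (simp add: trace_profile_def[abs_def])
qed

lemma continuous_on_trace_kernel_snd:
  assumes "u \<in> {0..1}"
  shows "continuous_on {0..1} (trace_kernel u)"
proof -
  have "continuous_on {0..1} (\<lambda>t. case (u, t) of (u, t) \<Rightarrow> trace_kernel u t)"
    by (rule continuous_on_compose2[OF continuous_on_trace_kernel])
       (use assms in \<open>auto intro!: continuous_intros\<close>)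
  then show ?thesis by simp
qed

lemma trace_profile_eq:
  assumes "u \<in> {0..1}"
  shows "trace_profile u = integral {u..1} (trace_kernel u)"
proof -
  have "integral {0..u} (trace_kernel u) = integral {0..u} (\<lambda>_. 0)"
    by (rule integral_cong) (auto intro: trace_kernel_eq_0)
  moreover have "integral {0..u} (trace_kernel u) + integral {u..1} (trace_kernel u) = trace_profile u"
    unfolding trace_profile_def using assms
    by (intro Henstock_Kurzweil_Integration.integral_combine integrable_continuous_real continuous_on_trace_kernel_snd) auto
  ultimately show ?thesis by simp
qed

section \<open>Beta integrals and the moments of the profile\<close>

text \<open>Half the Beta value B(n + 1/2, 5/2).\<close>

definition sqrt_cube_moment :: "nat \<Rightarrow> real" where
  "sqrt_cube_moment n = integral {0..1} (\<lambda>s. s ^ (2 * n) * sqrt (1 - s\<^sup>2) ^ 3)"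

lemma sqrt_cube_moment_0: "sqrt_cube_moment 0 = 3 * pi / 16"
proof -
  \<comment> \<open>With r = sqrt (1 - s^2), an antiderivative of r^3 is s r^3 / 4 + 3/8 (s r +
    arcsin s). The derivatives of the root and of arcsin blow up at s = 1, hence the interior form
    of the fundamental theorem.\<close>
  have "((\<lambda>s::real. s ^ (2 * 0) * sqrt (1 - s\<^sup>2) ^ 3) has_integral
      (1 * sqrt (1 - 1\<^sup>2) ^ 3 / 4 + 3/8 * (1 * sqrt (1 - 1\<^sup>2) + arcsin 1))
      - (0 * sqrt (1 - 0\<^sup>2) ^ 3 / 4 + 3/8 * (0 * sqrt (1 - 0\<^sup>2) + arcsin 0))) {0..1}"
  proof (rule fundamental_theorem_of_calculus_interior)
    fix s :: real assume s: "s \<in> {0<..<1}"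
    then have pos: "1 - s\<^sup>2 > 0" by (simp add: power_less_one_iff abs_square_less_1)
    define r where "r = sqrt (1 - s\<^sup>2)"
    have r: "r > 0" "r\<^sup>2 = 1 - s\<^sup>2" using pos by (simp_all add: r_def)
    have dr: "((\<lambda>s. sqrt (1 - s\<^sup>2)) has_real_derivative - s / r) (at s)"
      using pos by (auto intro!: derivative_eq_intros simp: r_def divide_simps)
    have das: "(arcsin has_real_derivative 1 / r) (at s)"
      using DERIV_arcsin[of s] s by (simp add: r_def inverse_eq_divide)
    have "((\<lambda>s. s * sqrt (1 - s\<^sup>2) ^ 3 / 4 + 3/8 * (s * sqrt (1 - s\<^sup>2) + arcsin s)) has_real_derivative
        (r ^ 3 + s * (3 * r\<^sup>2 * (- s / r))) / 4 + 3/8 * ((r + s * (- s / r)) + 1 / r)) (at s)"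
      by (rule DERIV_cong[OF DERIV_add[OF DERIV_cdivide[OF DERIV_mult[OF DERIV_ident DERIV_power[OF dr, of 3]], of 4]
            DERIV_cmult[OF DERIV_add[OF DERIV_mult[OF DERIV_ident dr] das], of "3/8"]]])
         (simp add: r_def[symmetric])
    also have "(r ^ 3 + s * (3 * r\<^sup>2 * (- s / r))) / 4 + 3/8 * ((r + s * (- s / r)) + 1 / r) = r ^ 3"
    proof -
      have s2: "s * s = 1 - r\<^sup>2" using r by (simp add: power2_eq_square)
      have "(r ^ 3 + s * (3 * r\<^sup>2 * (- s / r))) / 4 + 3/8 * ((r + s * (- s / r)) + 1 / r)
          = (r ^ 3 - 3 * r * (s * s)) / 4 + 3/8 * (r + (1 - s * s) / r)"
        using r by (simp add: field_simps power2_eq_square)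
      also have "\<dots> = r ^ 3"
        unfolding s2 using r by (simp add: field_simps power2_eq_square power3_eq_cube)
      finally show ?thesis .
    qed
    finally show "((\<lambda>s. s * sqrt (1 - s\<^sup>2) ^ 3 / 4 + 3/8 * (s * sqrt (1 - s\<^sup>2) + arcsin s)) has_vector_derivative
        s ^ (2 * 0) * sqrt (1 - s\<^sup>2) ^ 3) (at s)"
      by (simp add: has_real_derivative_iff_has_vector_derivative r_def)
  qed (auto intro!: continuous_intros)
  then show ?thesis by (simp add: sqrt_cube_moment_def integral_unique)
qed

text \<open>The function s^(2 n + 1) (1 - s^2)^(5/2) vanishes at both ends. In its derivative one
  factor 1 - s^2 is multiplied out, and the coefficient 2 n + 6 is (2 n + 1) + 5.\<close>

lemma sqrt_cube_moment_Suc: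
  "real (2 * n + 6) * sqrt_cube_moment (Suc n) = real (2 * n + 1) * sqrt_cube_moment n"
proof -
  have "((\<lambda>s::real. (2 * n + 1) * (s ^ (2 * n) * sqrt (1 - s\<^sup>2) ^ 3)
        - (2 * n + 6) * (s ^ (2 * Suc n) * sqrt (1 - s\<^sup>2) ^ 3))
      has_integral 1 ^ (2 * n + 1) * sqrt (1 - 1\<^sup>2) ^ 5 - 0 ^ (2 * n + 1) * sqrt (1 - 0\<^sup>2) ^ 5) {0..1}"
  proof (rule fundamental_theorem_of_calculus_interior)
    fix s :: real assume s: "s \<in> {0<..<1}"
    then have pos: "1 - s\<^sup>2 > 0" by (simp add: power_less_one_iff abs_square_less_1)
    define r where "r = sqrt (1 - s\<^sup>2)"
    have r: "r > 0" "r\<^sup>2 = 1 - s\<^sup>2" using pos by (simp_all add: r_def)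
    have dr: "((\<lambda>s. sqrt (1 - s\<^sup>2)) has_real_derivative - s / r) (at s)"
      using pos by (auto intro!: derivative_eq_intros simp: r_def divide_simps)
    have "((\<lambda>s. s ^ (2 * n + 1) * sqrt (1 - s\<^sup>2) ^ 5) has_real_derivative
        (2 * n + 1) * s ^ (2 * n) * r ^ 5 + s ^ (2 * n + 1) * (5 * r ^ 4 * (- s / r))) (at s)"
      by (rule DERIV_cong[OF DERIV_mult[OF DERIV_power[OF DERIV_ident, of "2 * n + 1"] DERIV_power[OF dr, of 5]]])
         (simp add: r_def[symmetric])
    also have "(2 * n + 1) * s ^ (2 * n) * r ^ 5 + s ^ (2 * n + 1) * (5 * r ^ 4 * (- s / r))
        = (2 * n + 1) * (s ^ (2 * n) * (r ^ 3 * r\<^sup>2)) - 5 * (s ^ (2 * Suc n) * r ^ 3)"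
      using r by (simp add: field_simps power2_eq_square eval_nat_numeral)
    also have "\<dots> = (2 * n + 1) * (s ^ (2 * n) * r ^ 3) - (2 * n + 6) * (s ^ (2 * Suc n) * r ^ 3)"
      unfolding r(2) by (simp add: algebra_simps power2_eq_square)
    finally show "((\<lambda>s. s ^ (2 * n + 1) * sqrt (1 - s\<^sup>2) ^ 5) has_vector_derivative
        (2 * n + 1) * (s ^ (2 * n) * sqrt (1 - s\<^sup>2) ^ 3) - (2 * n + 6) * (s ^ (2 * Suc n) * sqrt (1 - s\<^sup>2) ^ 3)) (at s)"
      by (simp add: has_real_derivative_iff_has_vector_derivative r_def)
  qed (auto intro!: continuous_intros)
  then have "integral {0..1} (\<lambda>s::real. (2 * n + 1) * (s ^ (2 * n) * sqrt (1 - s\<^sup>2) ^ 3)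
        - (2 * n + 6) * (s ^ (2 * Suc n) * sqrt (1 - s\<^sup>2) ^ 3)) = 0"
    by (simp add: integral_unique)
  moreover have "integral {0..1} (\<lambda>s::real. (2 * n + 1) * (s ^ (2 * n) * sqrt (1 - s\<^sup>2) ^ 3)
        - (2 * n + 6) * (s ^ (2 * Suc n) * sqrt (1 - s\<^sup>2) ^ 3))
      = (2 * n + 1) * sqrt_cube_moment n - (2 * n + 6) * sqrt_cube_moment (Suc n)"
    unfolding sqrt_cube_moment_def
    by (subst Henstock_Kurzweil_Integration.integral_diff)
       (auto intro!: integrable_continuous_real continuous_intros)
  ultimately show ?thesis by linarith
qed

lemma sqrt_cube_moment: "sqrt_cube_moment n = 3 * pi / 8 * fact (2 * n) / (4 ^ n * fact n * fact (n + 2))"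
proof (induction n)
  case 0
  then show ?case by (simp add: sqrt_cube_moment_0)
next
  case (Suc n)
  have "sqrt_cube_moment (Suc n) = (2 * n + 1) / (2 * n + 6) * sqrt_cube_moment n"
    using sqrt_cube_moment_Suc[of n] by (simp add: field_simps)
  also have "\<dots> = (2 * n + 1) / (2 * n + 6) * (3 * pi / 8 * fact (2 * n) / (4 ^ n * fact n * fact (n + 2)))"
    by (simp only: Suc.IH)
  also have "\<dots> = 3 * pi / 8 * fact (2 * Suc n) / (4 ^ Suc n * fact (Suc n) * fact (Suc n + 2))"
    by (simp add: divide_simps) (simp add: algebra_simps)
  finally show ?case .
qed

text \<open>Substituting u = t s gives t^(2 n) from the power, t^3 from the root and t from du; the
  range u > t contributes nothing.\<close>

lemma scaled_sqrt_cube_moment: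
  assumes t: "0 < t" "t \<le> 1"
  shows "integral {0..1} (\<lambda>u. u ^ (2 * n) * sqrt (max 0 (t\<^sup>2 - u\<^sup>2)) ^ 3) = t ^ (2 * n + 4) * sqrt_cube_moment n"
proof -
  let ?h = "\<lambda>u::real. u ^ (2 * n) * sqrt (max 0 (t\<^sup>2 - u\<^sup>2)) ^ 3"
  have "integral {t..1} ?h = integral {t..1} (\<lambda>_. 0)"
  proof (rule integral_cong)
    fix u assume "u \<in> {t..1}"
    then have "t\<^sup>2 \<le> u\<^sup>2" using t by (intro power_mono) auto
    then show "?h u = 0" by simp
  qed
  moreover have "integral {0..t} ?h + integral {t..1} ?h = integral {0..1} ?h"
    using t by (intro Henstock_Kurzweil_Integration.integral_combine integrable_continuous_real continuous_intros) auto
  moreover have "((\<lambda>u. (1/t) *\<^sub>R ((u/t) ^ (2 * n) * sqrt (1 - (u/t)\<^sup>2) ^ 3)) has_integral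
      integral {0/t..t/t} (\<lambda>s. s ^ (2 * n) * sqrt (1 - s\<^sup>2) ^ 3)) {0..t}"
    using t by (intro has_integral_substitution[where c = 0 and d = 1])
      (auto intro!: continuous_intros derivative_eq_intros simp: divide_simps)
  then have "((\<lambda>u. t ^ (2 * n + 4) * ((1/t) *\<^sub>R ((u/t) ^ (2 * n) * sqrt (1 - (u/t)\<^sup>2) ^ 3))) has_integral
      t ^ (2 * n + 4) * sqrt_cube_moment n) {0..t}"
    using t by (intro has_integral_mult_right) (simp add: sqrt_cube_moment_def)
  then have "(?h has_integral t ^ (2 * n + 4) * sqrt_cube_moment n) {0..t}"
  proof (rule has_integral_eq[rotated])
    fix u assume u: "u \<in> {0..t}"
    then have "u\<^sup>2 \<le> t\<^sup>2" using t by (intro power_mono) auto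
    then have m: "max 0 (t\<^sup>2 - u\<^sup>2) = t\<^sup>2 * (1 - (u/t)\<^sup>2)"
      using t by (simp add: field_simps)
    show "t ^ (2 * n + 4) * ((1/t) *\<^sub>R ((u/t) ^ (2 * n) * sqrt (1 - (u/t)\<^sup>2) ^ 3)) = ?h u"
      unfolding m real_sqrt_mult using t
      by (simp add: power_mult_distrib power_divide power_add eval_nat_numeral)
  qed
  ultimately show ?thesis by (simp add: integral_unique)
qed

text \<open>After exchanging the integrals, the inner one scales as t^(2 n + 4). Division by t^2
  leaves t^(2 (n + 1)), hence the shifted index of the second factor.\<close>

lemma trace_profile_moment:
  "integral {0..1} (\<lambda>u. u ^ (2 * n) * trace_profile u) = sqrt_cube_moment n * sqrt_cube_moment (Suc n)"
proof -
  have "integral {0..1} (\<lambda>u. u ^ (2 * n) * trace_profile u)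
      = integral (cbox 0 1) (\<lambda>u. integral (cbox 0 1) (\<lambda>t. u ^ (2 * n) * trace_kernel u t))"
    by (simp add: trace_profile_def)
  also have "\<dots> = integral (cbox 0 1) (\<lambda>t. integral (cbox 0 1) (\<lambda>u. u ^ (2 * n) * trace_kernel u t))"
  proof (rule integral_swap_continuous)
    have "continuous_on ({0..1} \<times> {0..1}) (\<lambda>p. fst p ^ (2 * n) * (\<lambda>(u, t). trace_kernel u t) p)"
      by (intro continuous_intros continuous_on_trace_kernel)
    then show "continuous_on (cbox (0, 0) (1, 1)) (\<lambda>(u, t). u ^ (2 * n) * trace_kernel u t)"
      by (simp add: split_beta cbox_Pair_eq)
  qed
  also have "\<dots> = integral {0..1} (\<lambda>t. sqrt_cube_moment n * (t ^ (2 * Suc n) * sqrt (1 - t\<^sup>2) ^ 3))"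
    unfolding cbox_interval
  proof (rule integral_cong)
    fix t :: real assume t: "t \<in> {0..1}"
    have "integral {0..1} (\<lambda>u. u ^ (2 * n) * trace_kernel u t)
        = integral {0..1} (\<lambda>u. (sqrt (1 - t\<^sup>2) ^ 3 / t\<^sup>2) * (u ^ (2 * n) * sqrt (max 0 (t\<^sup>2 - u\<^sup>2)) ^ 3))"
      by (rule integral_cong) (simp add: trace_kernel_def power_mult_distrib)
    also have "\<dots> = sqrt (1 - t\<^sup>2) ^ 3 / t\<^sup>2 * integral {0..1} (\<lambda>u. u ^ (2 * n) * sqrt (max 0 (t\<^sup>2 - u\<^sup>2)) ^ 3)"
      by simp
    also have "\<dots> = sqrt_cube_moment n * (t ^ (2 * Suc n) * sqrt (1 - t\<^sup>2) ^ 3)"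
    \<comment> \<open>At t = 0 both sides are 0: the left by division by zero, the right by the
      positive power of t.\<close>
    proof (cases "t = 0")
      case False
      then have "t > 0" "t \<le> 1" using t by auto
      then show ?thesis
        by (subst scaled_sqrt_cube_moment) (simp_all add: power_add eval_nat_numeral)
    qed simp
    finally show "integral {0..1} (\<lambda>u. u ^ (2 * n) * trace_kernel u t) = \<dots>" .
  qed
  also have "\<dots> = sqrt_cube_moment n * sqrt_cube_moment (Suc n)"
    by (simp add: sqrt_cube_moment_def)
  finally show ?thesis .
qed

section \<open>Reduction of the Legendre integral to the profile\<close>

text \<open>Two integrations by parts are merged into the antiderivative \<open>?G\<close>: cos (2
  t) is the derivative of sin t cos t, and the sin^2 t cos t that appears is a third of the
  derivative of sin^3 t. All boundary terms contain sin t.\<close>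

lemma integral_sqrt_cos2_by_parts:
  fixes z w :: real
  assumes D: "\<And>t. z + w * cos t > 0"
  shows "integral {0..pi} (\<lambda>t. sqrt (z + w * cos t) * cos (2 * t))
    = - (w\<^sup>2 / 12) * integral {0..pi} (\<lambda>t. sin t ^ 4 / sqrt (z + w * cos t) ^ 3)"
proof -
  let ?R = "\<lambda>t. sqrt (z + w * cos t)"
  let ?G = "\<lambda>t. ?R t * (sin t * cos t) + w / 6 * (sin t ^ 3 / ?R t)"
  have R: "?R t \<noteq> 0" for t using D[of t] by simp
  have "((\<lambda>t. ?R t * cos (2 * t) + w\<^sup>2 / 12 * (sin t ^ 4 / ?R t ^ 3)) has_integral ?G pi - ?G 0) {0..pi}"
  proof (rule fundamental_theorem_of_calculus)
    fix t :: real
    define r c s where "r = ?R t" and "c = cos t" and "s = sin t"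
    have r: "r > 0" using D[of t] by (simp add: r_def)
    have sc: "s\<^sup>2 + c\<^sup>2 = 1" by (simp add: s_def c_def)
    have dr: "(?R has_real_derivative - w * s / (2 * r)) (at t)"
      using D[of t] by (auto intro!: derivative_eq_intros simp: r_def s_def divide_simps)
    have "(?G has_real_derivative (- w * s / (2 * r)) * (s * c) + r * (c * c - s * s)
        + w / 6 * ((3 * s\<^sup>2 * c * r - s ^ 3 * (- w * s / (2 * r))) / r\<^sup>2)) (at t)"
      by (rule DERIV_cong[OF DERIV_add[OF DERIV_mult[OF dr DERIV_mult[OF DERIV_sin DERIV_cos]]
            DERIV_cmult[OF DERIV_divide[OF DERIV_power[OF DERIV_sin, of 3] dr R], of "w/6"]]])
         (simp only: r_def[symmetric], simp add: s_def[symmetric] c_def[symmetric] power2_eq_square)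
    also have "(- w * s / (2 * r)) * (s * c) + r * (c * c - s * s)
        + w / 6 * ((3 * s\<^sup>2 * c * r - s ^ 3 * (- w * s / (2 * r))) / r\<^sup>2)
      = r * (c\<^sup>2 - s\<^sup>2) + w\<^sup>2 / 12 * (s ^ 4 / r ^ 3)"
      using r by (simp add: field_simps eval_nat_numeral)
    also have "c\<^sup>2 - s\<^sup>2 = cos (2 * t)"
      by (simp add: cos_double c_def s_def)
    finally show "(?G has_vector_derivative ?R t * cos (2 * t) + w\<^sup>2 / 12 * (sin t ^ 4 / ?R t ^ 3)) (at t within {0..pi})"
      by (simp add: has_real_derivative_iff_has_vector_derivative r_def s_def has_vector_derivative_at_within)
  qed simp
  then have "integral {0..pi} (\<lambda>t. ?R t * cos (2 * t) + w\<^sup>2 / 12 * (sin t ^ 4 / ?R t ^ 3)) = 0"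
    by (simp add: integral_unique)
  moreover have "integral {0..pi} (\<lambda>t. ?R t * cos (2 * t) + w\<^sup>2 / 12 * (sin t ^ 4 / ?R t ^ 3))
      = integral {0..pi} (\<lambda>t. ?R t * cos (2 * t)) + integral {0..pi} (\<lambda>t. w\<^sup>2 / 12 * (sin t ^ 4 / ?R t ^ 3))"
    using R by (intro Henstock_Kurzweil_Integration.integral_add integrable_continuous_real continuous_intros) auto
  moreover have "integral {0..pi} (\<lambda>t. w\<^sup>2 / 12 * (sin t ^ 4 / ?R t ^ 3)) = w\<^sup>2 / 12 * integral {0..pi} (\<lambda>t. sin t ^ 4 / ?R t ^ 3)"
    by (rule integral_mult_right)
  ultimately show ?thesis by linarith
qed

text \<open>Substitute T = sqrt (u (z + w cos t)). The product of T^2 - u^2 and 1 - T^2 is then the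
  square of (1 - u^2) sin t / 2; its root cubed supplies sin^3 t, and dT the fourth sine.\<close>

lemma integral_sin4_trace_profile:
  fixes u :: real
  defines "z \<equiv> (u\<^sup>2 + 1) / (2 * u)" and "w \<equiv> (1 - u\<^sup>2) / (2 * u)"
  assumes u: "0 < u" "u < 1"
  shows "integral {0..pi} (\<lambda>t. sin t ^ 4 / sqrt (z + w * cos t) ^ 3)
    = 32 * (u * sqrt u) / (1 - u\<^sup>2) ^ 4 * trace_profile u"
proof -
  define v where "v = 1 - u\<^sup>2"
  have v: "v > 0" using u by (simp add: v_def power_less_one_iff)
  have w: "w = v / (2 * u)" by (simp add: w_def v_def)
  define T where "T t = sqrt u * sqrt (z + w * cos t)" for t
  have uD: "u * (z + w * cos t) = 1 - v * ((1 - cos t) / 2)" for t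
    using u by (simp add: z_def w_def v_def field_simps power2_eq_square)
  have uD': "u * (z + w * cos t) = u\<^sup>2 + v * ((1 + cos t) / 2)" for t
    using u by (simp add: z_def w_def v_def field_simps power2_eq_square)
  have c1: "0 \<le> (1 + cos t) / 2" for t :: real
    using add_left_mono[OF cos_ge_minus_one[of t], of 1] by simp
  have "0 < u * (z + w * cos t)" for t
    unfolding uD' using u v c1[of t] by (intro add_pos_nonneg mult_nonneg_nonneg) auto
  then have D: "0 < z + w * cos t" for t using u by (simp add: zero_less_mult_iff)
  have T2: "(T t)\<^sup>2 = u * (z + w * cos t)" for t
    using D[of t] u by (simp add: T_def power_mult_distrib)
  have T_pos: "T t > 0" for t using D[of t] u by (simp add: T_def)
  have T_range: "T t \<in> {u..1}" for t
  proof -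
    have "u\<^sup>2 \<le> (T t)\<^sup>2" unfolding T2 uD' using mult_nonneg_nonneg[OF less_imp_le[OF v] c1[of t]] by linarith
    moreover have "(T t)\<^sup>2 \<le> 1\<^sup>2" unfolding T2 uD using v by simp
    ultimately show ?thesis
      using u T_pos[of t] by (auto intro: power2_le_imp_le less_imp_le)
  qed
  have T0: "T 0 = 1" and Tpi: "T pi = u"
  proof -
    have "(T 0)\<^sup>2 = 1\<^sup>2" "(T pi)\<^sup>2 = u\<^sup>2"
      unfolding T2 uD' by (simp_all add: v_def)
    then show "T 0 = 1" "T pi = u"
      using T_pos[of 0] T_pos[of pi] u by (auto intro: power2_eq_imp_eq)
  qed
  define T' where "T' t = - (sqrt u * w * sin t) / (2 * sqrt (z + w * cos t))" for t
  have T': "(T has_real_derivative T' t) (at t within {0..pi})" for t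
    unfolding T_def T'_def using D[of t] by (auto intro!: derivative_eq_intros simp: divide_simps)
  \<comment> \<open>T falls from 1 to u, so \<open>{T 0..T pi}\<close> is empty and the profile
    appears with a minus sign.\<close>
  have "((\<lambda>t. T' t *\<^sub>R trace_kernel u (T t)) has_integral
      integral {T 0..T pi} (trace_kernel u) - integral {T pi..T 0} (trace_kernel u)) {0..pi}"
  proof (rule has_integral_substitution_general[where s = "{}" and c = u and d = 1])
    show "continuous_on {u..1} (trace_kernel u)"
      using u by (intro continuous_on_subset[OF continuous_on_trace_kernel_snd]) auto
    show "continuous_on {0..pi} T"
      using T' by (intro DERIV_continuous_on)
  qed (use T_range T' in auto)
  then have 1: "((\<lambda>t. T' t * trace_kernel u (T t)) has_integral - trace_profile u) {0..pi}"
    using u by (simp add: T0 Tpi trace_profile_eq)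
  have eq: "T' t * trace_kernel u (T t) = - (v ^ 4 / (32 * (u * sqrt u))) * (sin t ^ 4 / sqrt (z + w * cos t) ^ 3)"
    if t: "t \<in> {0..pi}" for t
  proof -
    define r where "r = sqrt (z + w * cos t)"
    have r: "r > 0" "r\<^sup>2 = z + w * cos t" using D[of t] by (simp_all add: r_def)
    define q where "q = sqrt u"
    have q: "q > 0" "q\<^sup>2 = u" using u by (simp_all add: q_def)
    have s: "sin t \<ge> 0" using t by (simp add: sin_ge_zero)
    have a: "(T t)\<^sup>2 - u\<^sup>2 = v * ((1 + cos t) / 2)" unfolding T2 uD' by simp
    have b: "1 - (T t)\<^sup>2 = v * ((1 - cos t) / 2)" unfolding T2 uD by simp
    have "sqrt (max 0 ((T t)\<^sup>2 - u\<^sup>2)) * sqrt (1 - (T t)\<^sup>2) = sqrt ((v * ((1 + cos t) / 2)) * (v * ((1 - cos t) / 2)))"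
      unfolding a b real_sqrt_mult[symmetric] using mult_nonneg_nonneg[OF less_imp_le[OF v] c1[of t]]
      by (simp only: max_absorb2)
    also have "(v * ((1 + cos t) / 2)) * (v * ((1 - cos t) / 2)) = (v / 2 * sin t)\<^sup>2"
      by (simp add: power_mult_distrib sin_squared_eq power_divide) (simp add: algebra_simps power2_eq_square)
    also have "sqrt \<dots> = v / 2 * sin t"
      using v s by (simp add: real_sqrt_abs)
    finally have "trace_kernel u (T t) = (v / 2 * sin t) ^ 3 / (T t)\<^sup>2"
      unfolding trace_kernel_def by (rule arg_cong)
    then have K: "trace_kernel u (T t) = (v / 2 * sin t) ^ 3 / (q\<^sup>2 * r\<^sup>2)"
      by (simp only: T2 q r)
    have T'_eq: "T' t = - (q * v / (2 * q\<^sup>2) * sin t) / (2 * r)"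
      unfolding T'_def q_def[symmetric] r_def[symmetric] by (simp add: w q(2))
    show ?thesis
      unfolding K T'_eq q_def[symmetric] r_def[symmetric] unfolding q(2)[symmetric] using q(1) r(1)
      by (simp add: field_simps eval_nat_numeral)
  qed
  have 2: "((\<lambda>t. - (v ^ 4 / (32 * (u * sqrt u))) * (sin t ^ 4 / sqrt (z + w * cos t) ^ 3)) has_integral - trace_profile u) {0..pi}"
    by (rule has_integral_eq[OF _ 1]) (rule eq)
  have "- (v ^ 4 / (32 * (u * sqrt u))) * integral {0..pi} (\<lambda>t. sin t ^ 4 / sqrt (z + w * cos t) ^ 3) = - trace_profile u"
    using integral_unique[OF 2] by (simp only: integral_mult_right)
  then show ?thesis
    using u v unfolding v_def[symmetric] by (simp add: field_simps)
qed

text \<open>For z = (u + 1/u) / 2 the root of z^2 - 1 is w = (1/u - u) / 2, so z - w = u keeps the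
  base of the power positive. The prefactor 15/4 is (3/2) (5/2).\<close>

lemma assoc_legendre_P_half_2:
  fixes u :: real
  assumes u: "0 < u" "u < 1"
  shows "assoc_legendre_P (1/2) 2 ((u\<^sup>2 + 1) / (2 * u)) = - (5 / (2 * pi)) * trace_profile u / (sqrt u * (1 - u\<^sup>2)\<^sup>2)"
proof -
  define z where "z = (u\<^sup>2 + 1) / (2 * u)"
  define w where "w = (1 - u\<^sup>2) / (2 * u)"
  have v: "1 - u\<^sup>2 > 0" using u by (simp add: power_less_one_iff)
  have w0: "w > 0" using u v by (simp add: w_def)
  have "z\<^sup>2 - 1 = w\<^sup>2"
    using u by (simp add: z_def w_def power_divide divide_simps) (simp add: algebra_simps power2_eq_square)
  then have sw: "sqrt (z\<^sup>2 - 1) = w" using w0 by simp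
  have zw: "z - w = u"
    using u by (simp add: z_def w_def diff_divide_distrib[symmetric] power2_eq_square)
  have D: "z + w * cos t > 0" for t
  proof -
    have "w * (- 1) \<le> w * cos t" using w0 by (intro mult_left_mono) auto
    then show ?thesis using zw u by simp
  qed
  have root: "(z + w * cos t) powr (1/2) = sqrt (z + w * cos t)" for t
    using D[of t] by (simp add: powr_half_sqrt)
  have poch: "pochhammer (1/2 + 1 :: real) 2 = 15 / 4"
    by (simp add: pochhammer_rec eval_nat_numeral)
  have "assoc_legendre_P (1/2) 2 z = 15 / (4 * pi) * integral {0..pi} (\<lambda>t. sqrt (z + w * cos t) * cos (2 * t))"
    unfolding assoc_legendre_P_def sw poch root by simp
  also have "\<dots> = 15 / (4 * pi) * (- (w\<^sup>2 / 12) * (32 * (u * sqrt u) / (1 - u\<^sup>2) ^ 4 * trace_profile u))"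
    unfolding integral_sqrt_cos2_by_parts[OF D] using integral_sin4_trace_profile[OF u]
    by (simp only: z_def[symmetric] w_def[symmetric])
  also have "\<dots> = - (5 / (2 * pi)) * trace_profile u / (sqrt u * (1 - u\<^sup>2)\<^sup>2)"
  proof -
    define q where "q = sqrt u"
    have q: "q > 0" "u = q\<^sup>2" using u by (simp_all add: q_def)
    define v where "v = 1 - u\<^sup>2"
    have v0: "v > 0" using v by (simp add: v_def)
    show ?thesis
      unfolding w_def q_def[symmetric] v_def[symmetric] using q(1) v0
      by (simp add: q(2) field_simps eval_nat_numeral)
  qed
  finally show ?thesis by (simp add: z_def)
qed

section \<open>The density on [-4, 4] and its moments\<close>

text \<open>The constant makes the total mass 1, as the case n = 0 of
  \<open>trace_density_moment_even\<close> shows.\<close>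

definition trace_density :: "real \<Rightarrow> real" where
  "trace_density x = 64 / (3 * pi\<^sup>2) * trace_profile (\<bar>x\<bar> / 4)"

text \<open>With u = |x| / 4, \<open>assoc_legendre_P_half_2\<close> is solved for the profile. The
  constant 64 / (15 pi) is 64 / (3 pi^2) times 2 pi / 5 times 1/2, the last because sqrt |x| = 2
  sqrt u.\<close>

lemma trace_density_eq_legendre:
  assumes "0 < \<bar>x\<bar>" "\<bar>x\<bar> < 4"
  shows "trace_density x = - (64 / (15 * pi)) * sqrt \<bar>x\<bar> * (1 - x\<^sup>2 / 16)\<^sup>2
                 * assoc_legendre_P (1/2) 2 ((x\<^sup>2 + 16) / (8 * \<bar>x\<bar>))"
proof -
  define u where "u = \<bar>x\<bar> / 4"
  have u: "0 < u" "u < 1" using assms by (simp_all add: u_def)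
  have v: "1 - u\<^sup>2 > 0" using u by (simp add: power_less_one_iff)
  have x: "\<bar>x\<bar> = 4 * u" by (simp add: u_def)
  have x2: "x\<^sup>2 = 16 * u\<^sup>2" by (simp add: u_def power_divide)
  have z: "(x\<^sup>2 + 16) / (8 * \<bar>x\<bar>) = (u\<^sup>2 + 1) / (2 * u)"
    unfolding x x2 using u by (simp add: divide_simps)
  have s: "sqrt \<bar>x\<bar> = 2 * sqrt u" by (simp add: x real_sqrt_mult)
  have d: "1 - x\<^sup>2 / 16 = 1 - u\<^sup>2" by (simp add: x2)
  show ?thesis
    unfolding z s d assoc_legendre_P_half_2[OF u] trace_density_def u_def[symmetric]
    using u v by (simp add: divide_simps power2_eq_square)
qed

lemma continuous_on_trace_density: "continuous_on {-4..4} trace_density"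
  unfolding trace_density_def
  by (intro continuous_intros continuous_on_compose2[OF continuous_on_trace_profile]) auto

text \<open>The positive half comes from x = 4 u, the negative half from reflection with sign
  (-1)^n; hence the doubled constant for even n.\<close>

lemma trace_density_moment:
  "integral {-4..4} (\<lambda>x. x ^ n * trace_density x) =
    (if even n then 128 / (3 * pi\<^sup>2) * 4 ^ Suc n * integral {0..1} (\<lambda>u. u ^ n * trace_profile u) else 0)"
proof -
  let ?h = "\<lambda>x. x ^ n * trace_density x"
  have cont: "continuous_on {-4..4} ?h"
    by (intro continuous_intros continuous_on_trace_density)
  have "((\<lambda>x. (1/4) *\<^sub>R ((x/4) ^ n * trace_profile (x/4))) has_integral
      integral {0/4..4/4} (\<lambda>u. u ^ n * trace_profile u)) {0..4}"
    by (intro has_integral_substitution[where c = 0 and d = 1])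
       (auto intro!: continuous_intros continuous_on_trace_profile derivative_eq_intros)
  then have "((\<lambda>x. 64 / (3 * pi\<^sup>2) * 4 ^ Suc n * ((1/4) *\<^sub>R ((x/4) ^ n * trace_profile (x/4)))) has_integral
      64 / (3 * pi\<^sup>2) * 4 ^ Suc n * integral {0..1} (\<lambda>u. u ^ n * trace_profile u)) {0..4}"
    by (intro has_integral_mult_right) simp
  then have pos: "(?h has_integral 64 / (3 * pi\<^sup>2) * 4 ^ Suc n * integral {0..1} (\<lambda>u. u ^ n * trace_profile u)) {0..4}"
    by (rule has_integral_eq[rotated]) (simp add: trace_density_def power_divide)
  have "((\<lambda>x. ?h (- x)) has_integral integral {0..4} ?h) {-4..-0}"
    using has_integral_reflect_real[where f = ?h and a = 0 and b = 4] pos by (simp only: integral_unique)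
  then have "((\<lambda>x. (-1) ^ n * ?h (- x)) has_integral (-1) ^ n * integral {0..4} ?h) {-4..0}"
    by (intro has_integral_mult_right) simp
  moreover have "(-1) ^ n * ?h (- x) = ?h x" for x
  proof -
    have "(-1) ^ n * (- x) ^ n = x ^ n"
      by (simp flip: power_mult_distrib)
    then show ?thesis
      by (simp only: mult.assoc[symmetric]) (simp add: trace_density_def)
  qed
  ultimately have "(?h has_integral (-1) ^ n * integral {0..4} ?h) {-4..0}"
    by simp
  then have neg: "integral {-4..0} ?h = (-1) ^ n * integral {0..4} ?h"
    by (rule integral_unique)
  have "integral {-4..0} ?h + integral {0..4} ?h = integral {-4..4} ?h"
    by (intro Henstock_Kurzweil_Integration.integral_combine integrable_continuous_real cont) auto
  then have "integral {-4..4} ?h = (-1) ^ n * integral {0..4} ?h + integral {0..4} ?h"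
    unfolding neg by simp
  then show ?thesis
    unfolding integral_unique[OF pos] by simp
qed

text \<open>The closed form is brought to the shape of \<open>tau_moment_even\<close>, so that the
  two moment sequences agree by rewriting.\<close>

lemma trace_density_moment_even:
  "integral {-4..4} (\<lambda>x. x ^ (2 * n) * trace_density x)
    = 6 * fact (2 * n) * fact (2 * n + 2) / (fact n * fact (n + 1) * fact (n + 2) * fact (n + 3))"
proof -
  have "integral {-4..4} (\<lambda>x. x ^ (2 * n) * trace_density x)
      = 128 / (3 * pi\<^sup>2) * 4 ^ Suc (2 * n) * (sqrt_cube_moment n * sqrt_cube_moment (Suc n))"
    by (simp add: trace_density_moment trace_profile_moment)
  also have "\<dots> = 6 * fact (2 * n) * fact (2 * n + 2) / (fact n * fact (n + 1) * fact (n + 2) * fact (n + 3))"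
  proof -
    have 1: "2 * Suc n = 2 * n + 2" "Suc n + 2 = n + 3" "Suc n = n + 1" "n + 1 + 2 = n + 3" by simp_all
    have 2: "(4::real) ^ Suc (2 * n) = 4 * (4 ^ n * 4 ^ n)" "(4::real) ^ (n + 1) = 4 * 4 ^ n"
      by (simp_all add: mult_2 power_add)
    show ?thesis
      unfolding sqrt_cube_moment 2(1) 1 2(2) by (simp add: field_simps power2_eq_square del: fact_Suc)
  qed
  finally show ?thesis .
qed

section \<open>Uniqueness\<close>

text \<open>Zero moments make d orthogonal to all polynomials. For a polynomial p uniformly close to
  d, the integral of d^2 equals that of d (d - p), which is arbitrarily small; so the continuous
  function d^2 has integral 0.\<close>

lemma continuous_moments_0_imp_0:
  fixes d :: "real \<Rightarrow> real"
  assumes d: "continuous_on {a..b} d"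
    and mom: "\<And>n. integral {a..b} (\<lambda>x. x ^ n * d x) = 0"
    and x: "x \<in> {a..b}" and ab: "a < b"
  shows "d x = 0"
proof -
  have poly0: "integral {a..b} (\<lambda>x. p x * d x) = 0" if pp: "real_polynomial_function p" for p
  proof -
    obtain c n where p: "p = (\<lambda>x. \<Sum>i\<le>n. c i * x ^ i)"
      using pp unfolding real_polynomial_function_iff_sum by (elim exE) (rule that)
    have "integral {a..b} (\<lambda>x. p x * d x) = integral {a..b} (\<lambda>x. \<Sum>i\<le>n. c i * (x ^ i * d x))"
      by (simp add: p sum_distrib_right mult.assoc)
    also have "\<dots> = (\<Sum>i\<le>n. integral {a..b} (\<lambda>x. c i * (x ^ i * d x)))"
      by (intro integral_sum) (auto intro!: integrable_continuous_real continuous_intros d)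
    also have "\<dots> = 0" using mom by simp
    finally show ?thesis .
  qed
  have int2: "(\<lambda>x. d x * d x) integrable_on {a..b}"
    by (intro integrable_continuous_real continuous_intros d)
  let ?K = "integral {a..b} (\<lambda>x. \<bar>d x\<bar>)"
  have K: "?K \<ge> 0" by (rule integral_nonneg) (auto intro!: integrable_continuous_real continuous_intros d)
  have "integral {a..b} (\<lambda>x. d x * d x) \<le> e" if e: "e > 0" for e
  proof -
    \<comment> \<open>The \<open>+ 1\<close> keeps the denominator positive when the integral of |d|
      is 0.\<close>
    define e' where "e' = e / (?K + 1)"
    have e': "e' > 0" using e K by (simp add: e'_def)
    obtain p where p: "real_polynomial_function p" "\<And>x. x \<in> {a..b} \<Longrightarrow> \<bar>d x - p x\<bar> < e'"
      using Stone_Weierstrass_real_polynomial_function[OF compact_Icc d e'] by blast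
    have pc: "continuous_on {a..b} p"
      using p(1) real_polynomial_function_eq continuous_on_polymonial_function by blast
    have "integral {a..b} (\<lambda>x. d x * d x) = integral {a..b} (\<lambda>x. d x * d x) - integral {a..b} (\<lambda>x. p x * d x)"
      using poly0[OF p(1)] by simp
    also have "\<dots> = integral {a..b} (\<lambda>x. d x * d x - p x * d x)"
      by (rule integral_diff[symmetric]) (auto intro!: integrable_continuous_real continuous_intros d pc)
    also have "\<dots> \<le> integral {a..b} (\<lambda>x. e' * \<bar>d x\<bar>)"
    proof (rule integral_le)
      fix x assume "x \<in> {a..b}"
      then have "\<bar>d x - p x\<bar> * \<bar>d x\<bar> \<le> e' * \<bar>d x\<bar>"
        using p(2) by (intro mult_right_mono) (auto intro: less_imp_le)
      then show "d x * d x - p x * d x \<le> e' * \<bar>d x\<bar>"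
        by (simp add: abs_mult[symmetric] left_diff_distrib)
    qed (auto intro!: integrable_continuous_real continuous_intros d pc)
    also have "\<dots> = e' * ?K" by simp
    also have "\<dots> \<le> e' * (?K + 1)" using e' by simp
    also have "\<dots> = e" using K by (simp add: e'_def)
    finally show ?thesis .
  qed
  then have "integral {a..b} (\<lambda>x. d x * d x) \<le> 0"
    by (rule field_le_epsilon[OF ord_le_eq_trans]) simp_all
  moreover have "integral {a..b} (\<lambda>x. d x * d x) \<ge> 0" by (rule integral_nonneg[OF int2]) simp
  ultimately have "integral {a..b} (\<lambda>x. d x * d x) = 0" by linarith
  then have "((\<lambda>x. d x * d x) has_integral 0) (cbox a b)"
    using integrable_integral[OF int2] by simp
  then have "d x * d x = 0"
    by (rule has_integral_0_cbox_imp_0[rotated 2])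
       (use x ab in \<open>auto intro!: continuous_on_mult d simp: box_real\<close>)
  then show ?thesis by simp
qed

theorem theorem5p4:
  fixes dm :: "(complex^4^4) measure" and f\<^sub>\<tau> :: "real \<Rightarrow> real" and x :: real
  assumes "normalized_haar USp4 dm"
    and "continuous_tau_density dm f\<^sub>\<tau>"
    and "0 < \<bar>x\<bar>" and "\<bar>x\<bar> < 4"
  shows "f\<^sub>\<tau> x = - (64 / (15 * pi)) * sqrt \<bar>x\<bar> * (1 - x\<^sup>2 / 16)\<^sup>2
                 * assoc_legendre_P (1/2) 2 ((x\<^sup>2 + 16) / (8 * \<bar>x\<bar>))"
proof -
  \<comment> \<open>The powers of x serve as test functions in
    \<open>continuous_tau_density\<close>.\<close>
  have f: "continuous_on {-4..4} f\<^sub>\<tau>"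
    and f_moment: "integral {-4..4} (\<lambda>x. x ^ n * f\<^sub>\<tau> x) = (\<integral>m. tau m ^ n \<partial>dm)" for n
    using assms(2) continuous_on_power[OF continuous_on_id, of "{-4..4::real}" n]
    unfolding continuous_tau_density_def by auto
  have "f\<^sub>\<tau> x - trace_density x = 0"
  proof (rule continuous_moments_0_imp_0[where d = "\<lambda>x. f\<^sub>\<tau> x - trace_density x"])
    show "continuous_on {-4..4} (\<lambda>x. f\<^sub>\<tau> x - trace_density x)"
      by (intro continuous_intros f continuous_on_trace_density)
    show "integral {-4..4} (\<lambda>x. x ^ n * (f\<^sub>\<tau> x - trace_density x)) = 0" for n
    proof -
      have "integral {-4..4} (\<lambda>x. x ^ n * (f\<^sub>\<tau> x - trace_density x))
          = integral {-4..4} (\<lambda>x. x ^ n * f\<^sub>\<tau> x) - integral {-4..4} (\<lambda>x. x ^ n * trace_density x)"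
        unfolding right_diff_distrib
        by (intro Henstock_Kurzweil_Integration.integral_diff integrable_continuous_real continuous_intros
            f continuous_on_trace_density)
      also have "\<dots> = 0"
      proof (cases "even n")
        case True
        then obtain k where "n = 2 * k" by blast
        then show ?thesis
          by (simp only: f_moment tau_moment_even[OF assms(1)] trace_density_moment_even)
      next
        case False
        then show ?thesis
          by (simp add: f_moment tau_moment_odd[OF assms(1)] trace_density_moment)
      qed
      finally show ?thesis .
    qed
  qed (use assms in auto)
  then show ?thesis
    using trace_density_eq_legendre[OF assms(3,4)] by simp
qed

end
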